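(* Let $L_T$ be a trend-admissible operator of order $N_T\ge0$ and $L_S$ a seasonal-admissible operator of order $N_S\ge0$. Consider $\mathcal{M}_{L_T}(\mathbb{R})+\mathcal{M}_{L_S}(\mathbb{T})=\{f_T+f_S:(f_T,f_S)\in\mathcal{M}_{L_T}(\mathbb{R})\times\mathcal{M}_{L_S}(\mathbb{T})\}\subset\mathcal{S}'(\mathbb{R})$. (1) If $N_T=0$, then the sum is direct: $\mathcal{M}_{L_T}(\mathbb{R})+\mathcal{M}_{L_S}(\mathbb{T})=\mathcal{M}_{L_T}(\mathbb{R})\oplus\mathcal{M}_{L_S}(\mathbb{T})$. (2) If $N_T\ge1$, then one has the direct sum $\mathcal{M}_{L_T}(\mathbb{R})+\mathcal{M}_{L_S}(\mathbb{T})=\mathcal{M}_{L_T}(\mathbb{R})\oplus\mathcal{M}_{L_S,0}(\mathbb{T})$.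
   Context: $\mathbb{T}=\mathbb{R}/\mathbb{Z}$. $\mathcal{S}'(\mathbb{R})$ is the space of tempered distributions and $\mathcal{S}'(\mathbb{T})$ the space of $1$-periodic distributions (dual of the smooth $1$-periodic functions $\mathcal{S}(\mathbb{T})$), both with the weak*-topology; $\mathcal{S}'(\mathbb{T})$ is embedded in $\mathcal{S}'(\mathbb{R})$ through $\langle f,\varphi\rangle=\langle f,\sum_{k\in\mathbb{Z}}\varphi(\cdot-k)\rangle_{\mathcal{S}'(\mathbb{T})\times\mathcal{S}(\mathbb{T})}$ for $\varphi\in\mathcal{S}(\mathbb{R})$. $\mathcal{M}(\mathbb{R})$ is the space of finite Radon measures on $\mathbb{R}$ (dual of $\mathcal{C}_0(\mathbb{R})$), $\mathcal{M}(\mathbb{T})$ the dual of $\mathcal{C}(\mathbb{T})$. $\mathrm{D}$ is the derivative; LSI means linear and shift-invariant. Trend-admissible of order $N_T\ge0$: an LSI continuous operator $L_T:\mathcal{S}'(\mathbb{R})\to\mathcal{S}'(\mathbb{R})$ of the form $L_T=\mathrm{D}^{N_T}L_{\mathrm{inv},T}$, where $L_{\mathrm{inv},T}:\mathcal{S}'(\mathbb{R})\to\mathcal{S}'(\mathbb{R})$ is LSI, continuous, with LSI continuous inverse. Seasonal-admissible of order $N_S\ge0$: an LSI continuous operator $L_S:\mathcal{S}'(\mathbb{T})\to\mathcal{S}'(\mathbb{T})$ of the form $L_S=\mathrm{D}^{N_S}L_{\mathrm{inv},S}$ with $L_{\mathrm{inv},S}:\mathcal{S}'(\mathbb{T})\to\mathcal{S}'(\mathbb{T})$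 LSI, continuous, with LSI continuous inverse. $\mathcal{M}_{L_T}(\mathbb{R})=\{f\in\mathcal{S}'(\mathbb{R}):L_Tf\in\mathcal{M}(\mathbb{R})\}$, $\mathcal{M}_{L_S}(\mathbb{T})=\{f\in\mathcal{S}'(\mathbb{T}):L_Sf\in\mathcal{M}(\mathbb{T})\}$, $\mathcal{M}_{L_S,0}(\mathbb{T})=\{f\in\mathcal{M}_{L_S}(\mathbb{T}):\langle f,1\rangle_{\mathcal{S}'(\mathbb{T})\times\mathcal{S}(\mathbb{T})}=0\}$. *)

theory Defs
  imports "HOL-Analysis.Analysis" "HOL-Library.Function_Algebras" "HOL-Library.Set_Algebras"
begin

(* The scalars are an arbitrary type 'k of class {real_normed_field, euclidean_space};
   up to isomorphism these are exactly the real and the complex numbers, so that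
   real-valued and complex-valued distributions are treated at once.
   Functions on T = R/Z are 1-periodic functions on R. *)

type_synonym 'k fn = "real \<Rightarrow> 'k"
type_synonym 'k functional = "'k fn \<Rightarrow> 'k"

interpretation functional_space: vector_space
  "\<lambda>(c::'k::field) (u :: 'v \<Rightarrow> 'k) \<phi>. c * u \<phi>"
  by unfold_locales (auto simp: fun_eq_iff algebra_simps)

definition seminorm_topology ::
    "('k::real_normed_field) fn set \<Rightarrow> ('k fn \<Rightarrow> real) set \<Rightarrow> 'k fn topology" where
  "seminorm_topology V P =
     topology_generated_by {{\<psi> \<in> V. p (\<psi> - \<phi>) < r} | p \<phi> r. p \<in> P \<and> \<phi> \<in> V \<and> 0 < r}"

(* Functionals are total functions in HOL; they are normalized to be 0 outside V, so that
   equality, addition and scalar multiplication are those of functions.  The weak* topology on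
   the dual is then the subspace topology of the product topology, which is the
   topology that HOL-Analysis puts on function types; weak* continuity of an operator
   is therefore expressed with continuous_on. *)
definition top_dual ::
    "('k::real_normed_field) fn set \<Rightarrow> ('k fn \<Rightarrow> real) set \<Rightarrow> 'k functional set" where
  "top_dual V P = {u.
     (\<forall>\<phi>. \<phi> \<notin> V \<longrightarrow> u \<phi> = 0) \<and>
     (\<forall>\<phi>\<in>V. \<forall>\<psi>\<in>V. \<forall>a b. u (\<lambda>x. a * \<phi> x + b * \<psi> x) = a * u \<phi> + b * u \<psi>) \<and>
     continuous_map (seminorm_topology V P) euclidean u}"

definition fderiv1 :: "('k::real_normed_field) fn \<Rightarrow> 'k fn" where
  "fderiv1 \<phi> = (\<lambda>x. vector_derivative \<phi> (at x))"

definition smooth :: "('k::real_normed_field) fn \<Rightarrow> bool" where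
  "smooth \<phi> \<longleftrightarrow> (\<forall>n x. (fderiv1 ^^ n) \<phi> differentiable (at x))"

definition periodic1 :: "('k::real_normed_field) fn \<Rightarrow> bool" where
  "periodic1 \<phi> \<longleftrightarrow> (\<forall>x. \<phi> (x + 1) = \<phi> x)"

definition sup_norm :: "('k::real_normed_field) fn \<Rightarrow> real" where
  "sup_norm \<phi> = (SUP x. norm (\<phi> x))"

definition schwartz_R :: "('k::real_normed_field) fn set" where
  "schwartz_R = {\<phi>. smooth \<phi> \<and> (\<forall>m n. bounded (range (\<lambda>x. x ^ m *\<^sub>R (fderiv1 ^^ n) \<phi> x)))}"

definition schwartz_T :: "('k::real_normed_field) fn set" where
  "schwartz_T = {\<phi>. smooth \<phi> \<and> periodic1 \<phi>}"

definition tempered_R :: "('k::real_normed_field) functional set" where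
  "tempered_R =
     top_dual schwartz_R (range (\<lambda>(m, n) \<phi>. sup_norm (\<lambda>x. x ^ m *\<^sub>R (fderiv1 ^^ n) \<phi> x)))"

definition distributions_T :: "('k::real_normed_field) functional set" where
  "distributions_T = top_dual schwartz_T (range (\<lambda>n \<phi>. sup_norm ((fderiv1 ^^ n) \<phi>)))"

definition C0_R :: "('k::real_normed_field) fn set" where
  "C0_R = {\<phi>. continuous_on UNIV \<phi> \<and> (\<phi> \<longlongrightarrow> 0) at_infinity}"

definition C_T :: "('k::real_normed_field) fn set" where
  "C_T = {\<phi>. continuous_on UNIV \<phi> \<and> periodic1 \<phi>}"

definition measures_R :: "('k::real_normed_field) functional set" where
  "measures_R = top_dual C0_R {sup_norm}"

definition measures_T :: "('k::real_normed_field) functional set" where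
  "measures_T = top_dual C_T {sup_norm}"

(* A distribution is a measure if it is the restriction to test functions of one. *)
definition is_measure_R :: "('k::real_normed_field) functional \<Rightarrow> bool" where
  "is_measure_R f \<longleftrightarrow> (\<exists>\<mu>\<in>measures_R. \<forall>\<phi>\<in>schwartz_R. f \<phi> = \<mu> \<phi>)"

definition is_measure_T :: "('k::real_normed_field) functional \<Rightarrow> bool" where
  "is_measure_T f \<longleftrightarrow> (\<exists>\<mu>\<in>measures_T. \<forall>\<phi>\<in>schwartz_T. f \<phi> = \<mu> \<phi>)"

definition periodize :: "('k::real_normed_field) fn \<Rightarrow> 'k fn" where
  "periodize \<phi> = (\<lambda>x. \<Sum>\<^sub>\<infinity>k::int. \<phi> (x - of_int k))"

definition embed_T :: "('k::real_normed_field) functional \<Rightarrow> 'k functional" where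
  "embed_T f = (\<lambda>\<phi>. if \<phi> \<in> schwartz_R then f (periodize \<phi>) else 0)"

(* translate h f is f(. - h) *)
definition translate :: "real \<Rightarrow> ('k::real_normed_field) functional \<Rightarrow> 'k functional" where
  "translate h f = (\<lambda>\<phi>. f (\<lambda>x. \<phi> (x + h)))"

(* V is the space of test functions; the case distinction keeps the normalization
   of functionals to 0 outside V. *)
definition distr_deriv ::
    "('k::real_normed_field) fn set \<Rightarrow> 'k functional \<Rightarrow> 'k functional" where
  "distr_deriv V f = (\<lambda>\<phi>. if \<phi> \<in> V then - f (fderiv1 \<phi>) else 0)"

(* Only the values of an operator on the space W of distributions matter. *)
definition lsi_continuous ::
    "('k::real_normed_field) functional set \<Rightarrow> ('k functional \<Rightarrow> 'k functional) \<Rightarrow> bool" where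
  "lsi_continuous W L \<longleftrightarrow>
     (\<forall>f\<in>W. L f \<in> W) \<and>
     (\<forall>f\<in>W. \<forall>g\<in>W. \<forall>a b. L (\<lambda>\<phi>. a * f \<phi> + b * g \<phi>) = (\<lambda>\<phi>. a * L f \<phi> + b * L g \<phi>)) \<and>
     (\<forall>f\<in>W. \<forall>h. L (translate h f) = translate h (L f)) \<and>
     continuous_on W L"

definition admissible ::
    "('k::real_normed_field) fn set \<Rightarrow> 'k functional set \<Rightarrow> nat \<Rightarrow>
     ('k functional \<Rightarrow> 'k functional) \<Rightarrow> bool" where
  "admissible V W N L \<longleftrightarrow>
     lsi_continuous W L \<and>
     (\<exists>A B. lsi_continuous W A \<and> lsi_continuous W B \<and>
        (\<forall>f\<in>W. B (A f) = f \<and> A (B f) = f) \<and>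
        (\<forall>f\<in>W. L f = (distr_deriv V ^^ N) (A f)))"

definition trend_admissible ::
    "nat \<Rightarrow> (('k::real_normed_field) functional \<Rightarrow> 'k functional) \<Rightarrow> bool" where
  "trend_admissible = admissible schwartz_R tempered_R"

definition seasonal_admissible ::
    "nat \<Rightarrow> (('k::real_normed_field) functional \<Rightarrow> 'k functional) \<Rightarrow> bool" where
  "seasonal_admissible = admissible schwartz_T distributions_T"

definition M_R :: "(('k::real_normed_field) functional \<Rightarrow> 'k functional) \<Rightarrow> 'k functional set" where
  "M_R L = {f \<in> tempered_R. is_measure_R (L f)}"

definition M_T :: "(('k::real_normed_field) functional \<Rightarrow> 'k functional) \<Rightarrow> 'k functional set" where
  "M_T L = {f \<in> distributions_T. is_measure_T (L f)}"

definition M_T0 :: "(('k::real_normed_field) functional \<Rightarrow> 'k functional) \<Rightarrow> 'k functional set" where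
  "M_T0 L = {f \<in> M_T L. f (\<lambda>x. 1) = 0}"

definition is_direct_sum ::
    "('k::field) functional set \<Rightarrow> 'k functional set \<Rightarrow> 'k functional set \<Rightarrow> bool" where
  "is_direct_sum W U V \<longleftrightarrow>
     functional_space.subspace U \<and> functional_space.subspace V \<and>
     W = U + V \<and> (\<forall>w\<in>W. \<exists>!p. p \<in> U \<times> V \<and> w = fst p + snd p)"

end

(* For a test function phi and a distribution u, the function
   h |-> u (phi(. + h)) has derivative u (phi'(. + h)); hence shift invariance is the same as a vanishing
   derivative, and a 1-periodic u with D^N u = 0 already has D u = 0.  If f is 1-periodic and L_T f is a
   finite measure, that measure is 1-periodic and thus zero, because the averages of n integer shifts
   of a Schwartz function tend to 0 uniformly.  Inverting L_inv shows that f is 0 for N_T = 0 and shift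
   invariant otherwise, and a shift-invariant periodic distribution is a multiple of the mean. *)
theory Submission imports Defs begin

text \<open>On the line and on the circle alike, \<open>D\<close> acts on a functional through an
  ordinary derivative in the shift parameter. An element of the kernel of a power of
  \<open>D\<close> therefore gives polynomials in that parameter, and a periodic polynomial is
  constant; no Fourier series enter. To differentiate, the difference quotients of a test function
  must converge in every seminorm, hence the weighted Taylor estimate, and continuity of
  functionals, which is defined topologically, must first become a bound by finitely many seminorms.

  The two cases differ because of the constants. An operator \<open>L_S\<close> maps the constant
  distribution to a multiple of itself, which is a measure, so constants always lie in the seasonal
  space. For N_T \<ge> 1 they are also annihilated by \<open>L_T\<close>, so they lie in the trend
  space too: the mean can be moved from the seasonal to the trend summand, and prescribing mean zero
  removes exactly this overlap. For N_T = 0 the trend operator is injective and nothing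
  overlaps.\<close>

section \<open>Seminormed function spaces and their duals\<close>

lemma norm_le_sup_norm:
  assumes "bounded (range \<phi>)" shows "norm (\<phi> x) \<le> sup_norm \<phi>"
proof -
  obtain B where "\<And>x. norm (\<phi> x) \<le> B" using assms by (auto simp: bounded_iff)
  then show ?thesis unfolding sup_norm_def by (intro cSUP_upper bdd_aboveI2) auto
qed

lemma sup_norm_nonneg: "bounded (range \<phi>) \<Longrightarrow> 0 \<le> sup_norm \<phi>"
  using norm_le_sup_norm norm_ge_zero order_trans by blast

lemma sup_norm_le: "(\<And>x. norm (\<phi> x) \<le> B) \<Longrightarrow> sup_norm \<phi> \<le> B"
  unfolding sup_norm_def by (intro cSUP_least) auto

lemma top_dual_linear:
  "u \<in> top_dual V P \<Longrightarrow> \<phi> \<in> V \<Longrightarrow> \<psi> \<in> V \<Longrightarrow>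
   u (\<lambda>x. a * \<phi> x + b * \<psi> x) = a * u \<phi> + b * u \<psi>"
  unfolding top_dual_def by blast

lemma top_dual_outside: "u \<in> top_dual V P \<Longrightarrow> \<phi> \<notin> V \<Longrightarrow> u \<phi> = 0"
  unfolding top_dual_def by blast

text \<open>The quantitative form of continuity at 0 for the topology generated by \<open>P\<close>.
  The function \<open>q\<close> is arbitrary, so that it may be a seminorm composed with a linear
  map, as \<open>top_dual_comp\<close> requires.\<close>

definition dominated ::
    "('k::real_normed_field) fn set \<Rightarrow> ('k fn \<Rightarrow> real) set \<Rightarrow> ('k fn \<Rightarrow> real) \<Rightarrow> bool" where
  "dominated V P q \<longleftrightarrow>
     (\<exists>F C. finite F \<and> F \<subseteq> P \<and> 0 \<le> C \<and> (\<forall>\<phi>\<in>V. q \<phi> \<le> C * (\<Sum>p\<in>F. p \<phi>)))"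

text \<open>The single inequality \<open>lincomb_le\<close> packs homogeneity and the triangle
  inequality together, in the shape in which linearity of functionals is stated. Nonemptiness of
  \<open>P\<close> makes \<open>V\<close> the whole topological space: a topology generated by no
  sets lives on the empty set.\<close>

locale seminormed_space =
  fixes V :: "('k::real_normed_field) fn set" and P :: "('k fn \<Rightarrow> real) set"
  assumes zero_mem: "(\<lambda>x. 0) \<in> V"
    and lincomb_mem: "\<phi> \<in> V \<Longrightarrow> \<psi> \<in> V \<Longrightarrow> (\<lambda>x. a * \<phi> x + b * \<psi> x) \<in> V"
    and nonneg: "p \<in> P \<Longrightarrow> \<phi> \<in> V \<Longrightarrow> 0 \<le> p \<phi>"
    and lincomb_le: "p \<in> P \<Longrightarrow> \<phi> \<in> V \<Longrightarrow> \<psi> \<in> V \<Longrightarrow>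
      p (\<lambda>x. a * \<phi> x + b * \<psi> x) \<le> norm a * p \<phi> + norm b * p \<psi>"
    and nonempty: "P \<noteq> {}"
begin

lemma scale_mem: "\<phi> \<in> V \<Longrightarrow> (\<lambda>x. a * \<phi> x) \<in> V"
  using lincomb_mem[of \<phi> \<phi> a 0] by simp

lemma diff_mem: "\<phi> \<in> V \<Longrightarrow> \<psi> \<in> V \<Longrightarrow> \<phi> - \<psi> \<in> V"
  using lincomb_mem[of \<phi> \<psi> 1 "-1"] by (simp add: fun_diff_def)

lemma seminorm_scale: "p \<in> P \<Longrightarrow> \<phi> \<in> V \<Longrightarrow> p (\<lambda>x. a * \<phi> x) \<le> norm a * p \<phi>"
  using lincomb_le[of p \<phi> \<phi> a 0] by simp

lemma seminorm_zero: "p \<in> P \<Longrightarrow> p (\<lambda>x. 0) = 0"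
  using lincomb_le[of p "\<lambda>x. 0" "\<lambda>x. 0" 0 0] nonneg[of p "\<lambda>x. 0"] zero_mem by simp

lemma seminorm_triangle:
  assumes "p \<in> P" "\<phi> \<in> V" "\<psi> \<in> V" "\<eta> \<in> V"
  shows "p (\<phi> - \<eta>) \<le> p (\<phi> - \<psi>) + p (\<psi> - \<eta>)"
proof -
  have "\<phi> - \<eta> = (\<lambda>x. 1 * (\<phi> - \<psi>) x + 1 * (\<psi> - \<eta>) x)" by (auto simp: fun_eq_iff)
  then show ?thesis
    using lincomb_le[of p "\<phi> - \<psi>" "\<psi> - \<eta>" 1 1] diff_mem assms by simp
qed

section \<open>Neighbourhoods in the seminorm topology\<close>

definition seminorm_ball :: "('k fn \<Rightarrow> real) set \<Rightarrow> real \<Rightarrow> 'k fn \<Rightarrow> 'k fn set" where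
  "seminorm_ball F r \<phi> = {\<psi> \<in> V. \<forall>p\<in>F. p (\<psi> - \<phi>) < r}"

lemma seminorm_ball_mono: "F \<subseteq> G \<Longrightarrow> s \<le> r \<Longrightarrow> seminorm_ball G s \<phi> \<subseteq> seminorm_ball F r \<phi>"
  unfolding seminorm_ball_def by fastforce

lemma seminorm_diff_self: "p \<in> P \<Longrightarrow> p (\<phi> - \<phi>) = 0"
  using seminorm_zero by (simp add: zero_fun_def)

lemma centre_mem_seminorm_ball: "F \<subseteq> P \<Longrightarrow> 0 < r \<Longrightarrow> \<phi> \<in> V \<Longrightarrow> \<phi> \<in> seminorm_ball F r \<phi>"
  unfolding seminorm_ball_def using seminorm_diff_self by fastforce

text \<open>Induction on the generation of open sets. A subbasic set may be centred elsewhere; the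
  triangle inequality recentres it at any of its points, with what is left of the radius.
  Intersections take the union of the seminorm sets and the smaller radius.\<close>

lemma openin_seminorm_topology_imp:
  assumes "openin (seminorm_topology V P) U"
  shows "U \<subseteq> V \<and> (\<forall>\<phi>\<in>U. \<exists>F r. finite F \<and> F \<subseteq> P \<and> 0 < r \<and> seminorm_ball F r \<phi> \<subseteq> U)"
proof -
  have "generate_topology_on {{\<psi> \<in> V. p (\<psi> - \<phi>) < r} | p \<phi> r. p \<in> P \<and> \<phi> \<in> V \<and> 0 < r} U"
    using assms by (simp add: seminorm_topology_def openin_topology_generated_by_iff)
  then show ?thesis
  proof induction
    case Empty
    then show ?case by simp
  next
    case (Int A B)
    show ?case
    proof (intro conjI ballI)
      show "A \<inter> B \<subseteq> V" using Int.IH(1) by fast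
      fix \<phi> assume "\<phi> \<in> A \<inter> B"
      then obtain F r G s where F: "finite F" "F \<subseteq> P" "0 < r" "seminorm_ball F r \<phi> \<subseteq> A"
        and G: "finite G" "G \<subseteq> P" "0 < s" "seminorm_ball G s \<phi> \<subseteq> B"
        using Int.IH by (metis IntE)
      have "seminorm_ball (F \<union> G) (min r s) \<phi> \<subseteq> A \<inter> B"
        using F(4) G(4) seminorm_ball_mono[of F "F \<union> G" "min r s" r \<phi>]
          seminorm_ball_mono[of G "F \<union> G" "min r s" s \<phi>] by fastforce
      with F G show "\<exists>F r. finite F \<and> F \<subseteq> P \<and> 0 < r \<and> seminorm_ball F r \<phi> \<subseteq> A \<inter> B"
        by (intro exI[of _ "F \<union> G"] exI[of _ "min r s"]) simp
    qed
  next
    case (UN K)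
    show ?case
    proof (intro conjI ballI)
      show "\<Union>K \<subseteq> V" using UN.IH by blast
      fix \<phi> assume "\<phi> \<in> \<Union>K"
      then obtain A where A: "A \<in> K" "\<phi> \<in> A" by blast
      then obtain F r where "finite F" "F \<subseteq> P" "0 < r" "seminorm_ball F r \<phi> \<subseteq> A"
        using UN.IH by metis
      with A(1) show "\<exists>F r. finite F \<and> F \<subseteq> P \<and> 0 < r \<and> seminorm_ball F r \<phi> \<subseteq> \<Union>K"
        by (intro exI[of _ F] exI[of _ r]) auto
    qed
  next
    case (Basis S)
    then obtain p \<eta> r where S: "S = {\<psi> \<in> V. p (\<psi> - \<eta>) < r}" "p \<in> P" "\<eta> \<in> V" by auto
    show ?case
    proof (intro conjI ballI exI)
      show "S \<subseteq> V" using S(1) by fast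
      fix \<phi> assume \<phi>: "\<phi> \<in> S"
      show "finite {p}" "{p} \<subseteq> P" "0 < r - p (\<phi> - \<eta>)" using S \<phi> by auto
      show "seminorm_ball {p} (r - p (\<phi> - \<eta>)) \<phi> \<subseteq> S"
      proof
        fix \<psi> assume "\<psi> \<in> seminorm_ball {p} (r - p (\<phi> - \<eta>)) \<phi>"
        then have "\<psi> \<in> V" "p (\<psi> - \<phi>) < r - p (\<phi> - \<eta>)" by (simp_all add: seminorm_ball_def)
        moreover have "\<phi> \<in> V" using S(1) \<phi> by fast
        ultimately show "\<psi> \<in> S" using S(1) seminorm_triangle[OF S(2), of \<psi> \<phi> \<eta>] S(3) by simp
      qed
    qed
  qed
qed

lemma openin_seminorm_subbasis:
  assumes "p \<in> P" "\<phi> \<in> V" "0 < r"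
  shows "openin (seminorm_topology V P) {\<psi> \<in> V. p (\<psi> - \<phi>) < r}"
  unfolding seminorm_topology_def
  by (rule topology_generated_by_Basis) (use assms in blast)

lemma topspace_seminorm_topology: "topspace (seminorm_topology V P) = V"
proof
  show "topspace (seminorm_topology V P) \<subseteq> V"
    using openin_seminorm_topology_imp[OF openin_topspace] by blast
  obtain p where p: "p \<in> P" using nonempty by blast
  show "V \<subseteq> topspace (seminorm_topology V P)"
  proof
    fix \<phi> assume \<phi>: "\<phi> \<in> V"
    have "openin (seminorm_topology V P) {\<psi> \<in> V. p (\<psi> - \<phi>) < 1}"
      using openin_seminorm_subbasis p \<phi> zero_less_one by blast
    moreover have "\<phi> \<in> {\<psi> \<in> V. p (\<psi> - \<phi>) < 1}" using \<phi> seminorm_diff_self[OF p] by simp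
    ultimately show "\<phi> \<in> topspace (seminorm_topology V P)" using openin_subset by fast
  qed
qed

lemma openin_seminorm_ball:
  assumes "finite F" "F \<subseteq> P" "\<phi> \<in> V" "0 < r"
  shows "openin (seminorm_topology V P) (seminorm_ball F r \<phi>)"
  using assms(1,2)
proof (induction F)
  case empty
  have "seminorm_ball {} r \<phi> = topspace (seminorm_topology V P)"
    using topspace_seminorm_topology by (simp add: seminorm_ball_def)
  then show ?case by (metis openin_topspace)
next
  case (insert p F)
  have "openin (seminorm_topology V P) {\<psi> \<in> V. p (\<psi> - \<phi>) < r}"
    using openin_seminorm_subbasis[of p \<phi> r] insert.prems assms(3,4) by simp
  moreover have "openin (seminorm_topology V P) (seminorm_ball F r \<phi>)"
    using insert.IH insert.prems by fast
  moreover have "seminorm_ball (insert p F) r \<phi> = {\<psi> \<in> V. p (\<psi> - \<phi>) < r} \<inter> seminorm_ball F r \<phi>"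
    unfolding seminorm_ball_def by (auto simp del: minus_apply)
  ultimately show ?case by (simp only: openin_Int)
qed

section \<open>Bounds by finitely many seminorms and the dual space\<close>

lemma dominated_mem: "p \<in> P \<Longrightarrow> dominated V P p"
  unfolding dominated_def by (intro exI[of _ "{p}"] exI[of _ 1]) auto

lemma dominated_add:
  assumes "dominated V P q" "dominated V P r"
  shows "dominated V P (\<lambda>\<phi>. q \<phi> + r \<phi>)"
proof -
  obtain F C where F: "finite F" "F \<subseteq> P" "0 \<le> C" "\<And>\<phi>. \<phi> \<in> V \<Longrightarrow> q \<phi> \<le> C * (\<Sum>p\<in>F. p \<phi>)"
    using assms(1) unfolding dominated_def by auto
  obtain G D where G: "finite G" "G \<subseteq> P" "0 \<le> D" "\<And>\<phi>. \<phi> \<in> V \<Longrightarrow> r \<phi> \<le> D * (\<Sum>p\<in>G. p \<phi>)"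
    using assms(2) unfolding dominated_def by auto
  have "q \<phi> + r \<phi> \<le> (C + D) * (\<Sum>p\<in>F \<union> G. p \<phi>)" if \<phi>: "\<phi> \<in> V" for \<phi>
  proof -
    have "(\<Sum>p\<in>F. p \<phi>) \<le> (\<Sum>p\<in>F \<union> G. p \<phi>)" "(\<Sum>p\<in>G. p \<phi>) \<le> (\<Sum>p\<in>F \<union> G. p \<phi>)"
      using F G \<phi> nonneg by (auto intro!: sum_mono2)
    then have "C * (\<Sum>p\<in>F. p \<phi>) + D * (\<Sum>p\<in>G. p \<phi>) \<le> (C + D) * (\<Sum>p\<in>F \<union> G. p \<phi>)"
      unfolding distrib_right using F G by (intro add_mono mult_left_mono)
    then show ?thesis using F(4)[OF \<phi>] G(4)[OF \<phi>] by linarith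
  qed
  then show ?thesis
    unfolding dominated_def using F G
    by (intro exI[of _ "F \<union> G"] exI[of _ "C + D"]) auto
qed

lemma dominated_mult:
  assumes "dominated V P q" "0 \<le> c"
  shows "dominated V P (\<lambda>\<phi>. c * q \<phi>)"
proof -
  obtain F C where F: "finite F" "F \<subseteq> P" "0 \<le> C" "\<And>\<phi>. \<phi> \<in> V \<Longrightarrow> q \<phi> \<le> C * (\<Sum>p\<in>F. p \<phi>)"
    using assms(1) unfolding dominated_def by auto
  show ?thesis
    unfolding dominated_def using F assms(2)
    by (intro exI[of _ F] exI[of _ "c * C"]) (auto simp: mult.assoc intro!: mult_left_mono)
qed

lemma dominated_le:
  assumes "dominated V P q" "\<And>\<phi>. \<phi> \<in> V \<Longrightarrow> r \<phi> \<le> q \<phi>"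
  shows "dominated V P r"
  using assms unfolding dominated_def by (meson order_trans)

lemma dominated_sum:
  assumes "finite G" "\<And>q. q \<in> G \<Longrightarrow> dominated V P (f q)"
  shows "dominated V P (\<lambda>\<phi>. \<Sum>q\<in>G. f q \<phi>)"
  using assms
proof (induction G)
  case empty
  then show ?case by (auto simp: dominated_def intro!: exI[of _ "{}"])
next
  case (insert q G)
  then show ?case using dominated_add[of "f q" "\<lambda>\<phi>. \<Sum>q\<in>G. f q \<phi>"] by simp
qed

text \<open>The preimage of the unit ball contains a seminorm ball around 0 of some radius
  \<open>r\<close>. Scaling a test function into that ball and using linearity turns the bound 1
  into a bound by the seminorms.\<close>

lemma top_dual_dominated:
  assumes "u \<in> top_dual V P"
  shows "dominated V P (\<lambda>\<phi>. norm (u \<phi>))"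
proof -
  have lin: "u (\<lambda>x. a * \<phi> x + b * \<psi> x) = a * u \<phi> + b * u \<psi>"
    if "\<phi> \<in> V" "\<psi> \<in> V" for \<phi> \<psi> a b
    using assms that unfolding top_dual_def by blast
  have u0: "u (\<lambda>x. 0) = 0" using lin[OF zero_mem zero_mem, of 0 0] by simp
  have "continuous_map (seminorm_topology V P) euclidean u"
    using assms unfolding top_dual_def by blast
  from openin_continuous_map_preimage[OF this, of "ball 0 1"]
  have op: "openin (seminorm_topology V P) {\<phi> \<in> V. u \<phi> \<in> ball 0 1}"
    by (simp add: topspace_seminorm_topology)
  have "(\<lambda>x. 0) \<in> {\<phi> \<in> V. u \<phi> \<in> ball 0 1}" using zero_mem u0 by simp
  from bspec[OF conjunct2[OF openin_seminorm_topology_imp[OF op]] this]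
  obtain F r where F: "finite F" "F \<subseteq> P" "0 < r"
    and ball: "seminorm_ball F r (\<lambda>x. 0) \<subseteq> {\<phi> \<in> V. u \<phi> \<in> ball 0 1}"
    by (elim exE conjE)
  have "norm (u \<phi>) \<le> (1 / r) * (\<Sum>p\<in>F. p \<phi>)" if \<phi>: "\<phi> \<in> V" for \<phi>
  proof (rule field_le_epsilon)
    fix e :: real assume e: "0 < e"
    define s where "s = (\<Sum>p\<in>F. p \<phi>)"
    \<comment> \<open>All seminorms of \<phi> in \<open>F\<close> may vanish, so \<open>s\<close>
      cannot serve as a divisor. The surplus \<open>r * e\<close> makes \<open>t\<close> positive
      and contributes exactly \<open>e\<close> to \<open>t / r\<close>.\<close>
    define t where "t = s + r * e"
    have s: "0 \<le> s" unfolding s_def using F \<phi> nonneg by (auto intro!: sum_nonneg)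
    then have t: "0 < t" "s < t" using F e by (auto simp: t_def add_nonneg_pos)
    let ?\<psi> = "\<lambda>x. of_real (r / t) * \<phi> x"
    have "p ?\<psi> < r" if p: "p \<in> F" for p
    proof -
      have "p \<phi> \<le> s" unfolding s_def using F \<phi> nonneg p by (intro member_le_sum) auto
      then have "p \<phi> < t" using t by simp
      have "p ?\<psi> \<le> (r / t) * p \<phi>"
        using seminorm_scale[OF subsetD[OF F(2) p] \<phi>, of "of_real (r / t)"]
        unfolding norm_of_real using F(3) t(1) by (simp only: abs_of_pos divide_pos_pos)
      also have "\<dots> < (r / t) * t"
        using \<open>p \<phi> < t\<close> F t by (intro mult_strict_left_mono) auto
      finally show ?thesis using t by simp
    qed
    then have "?\<psi> \<in> seminorm_ball F r (\<lambda>x. 0)"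
      using scale_mem[OF \<phi>, of "of_real (r / t)"] by (simp add: seminorm_ball_def fun_diff_def)
    then have "?\<psi> \<in> {\<phi> \<in> V. u \<phi> \<in> ball 0 1}" using ball by fast
    then have "norm (u ?\<psi>) < 1" by simp
    moreover have "u ?\<psi> = of_real (r / t) * u \<phi>" using lin[OF \<phi> \<phi>, of "of_real (r / t)" 0] by simp
    ultimately have "(r / t) * norm (u \<phi>) < 1" using F t by (simp add: norm_mult norm_divide)
    then have "norm (u \<phi>) < t / r" using F t by (simp add: field_simps)
    also have "t / r = (1 / r) * (\<Sum>p\<in>F. p \<phi>) + e" using F by (simp add: t_def s_def field_simps)
    finally show "norm (u \<phi>) \<le> (1 / r) * (\<Sum>p\<in>F. p \<phi>) + e" by simp
  qed
  then show ?thesis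
    unfolding dominated_def using F by (intro exI[of _ F] exI[of _ "1 / r"]) auto
qed

lemma top_dual_iff:
  "u \<in> top_dual V P \<longleftrightarrow>
     (\<forall>\<phi>. \<phi> \<notin> V \<longrightarrow> u \<phi> = 0) \<and>
     (\<forall>\<phi>\<in>V. \<forall>\<psi>\<in>V. \<forall>a b. u (\<lambda>x. a * \<phi> x + b * \<psi> x) = a * u \<phi> + b * u \<psi>) \<and>
     dominated V P (\<lambda>\<phi>. norm (u \<phi>))" (is "_ \<longleftrightarrow> ?zero \<and> ?lin \<and> ?dom")
proof (intro iffI)
  assume "u \<in> top_dual V P"
  then show "?zero \<and> ?lin \<and> ?dom"
    using top_dual_dominated by (simp add: top_dual_def)
next
  assume R: "?zero \<and> ?lin \<and> ?dom"
  obtain F C where F: "finite F" "F \<subseteq> P" "0 \<le> C"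
    and bd: "\<And>\<phi>. \<phi> \<in> V \<Longrightarrow> norm (u \<phi>) \<le> C * (\<Sum>p\<in>F. p \<phi>)"
    using R unfolding dominated_def by auto
  have "openin (seminorm_topology V P) {\<phi> \<in> V. u \<phi> \<in> S}" if "open S" for S
  proof (subst openin_subopen, intro ballI)
    fix \<phi> assume \<phi>: "\<phi> \<in> {\<phi> \<in> V. u \<phi> \<in> S}"
    then obtain e where e: "0 < e" "ball (u \<phi>) e \<subseteq> S"
      using \<open>open S\<close> openE by blast
    \<comment> \<open>The summand 1 keeps the denominator positive when \<open>C\<close> is 0 or
      \<open>F\<close> is empty, and makes the final estimate strict.\<close>
    define r where "r = e / (C * card F + 1)"
    have r: "0 < r" unfolding r_def using F e by (intro divide_pos_pos add_nonneg_pos) auto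
    have "u \<psi> \<in> S" if "\<psi> \<in> seminorm_ball F r \<phi>" for \<psi>
    proof -
      have \<psi>: "\<psi> \<in> V" "\<And>p. p \<in> F \<Longrightarrow> p (\<psi> - \<phi>) < r"
        using that by (auto simp: seminorm_ball_def)
      have "u (\<psi> - \<phi>) = u \<psi> - u \<phi>"
      proof -
        have "u (\<lambda>x. 1 * \<psi> x + (- 1) * \<phi> x) = 1 * u \<psi> + (- 1) * u \<phi>"
          using R \<phi> \<psi> by blast
        then show ?thesis by (simp add: fun_diff_def)
      qed
      then have "norm (u \<psi> - u \<phi>) \<le> C * (\<Sum>p\<in>F. p (\<psi> - \<phi>))"
        using bd[of "\<psi> - \<phi>"] diff_mem \<phi> \<psi> by auto
      also have "\<dots> \<le> C * (\<Sum>p\<in>F. r)"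
        using \<psi>(2) F(3) by (intro mult_left_mono sum_mono) (auto intro: less_imp_le)
      also have "\<dots> < r * (C * card F + 1)" using r by (simp add: algebra_simps)
      also have "\<dots> = e"
      proof -
        have "C * card F + 1 > 0" using F by (intro add_nonneg_pos) auto
        then show ?thesis by (simp add: r_def)
      qed
      finally show ?thesis using e by (auto simp: dist_norm norm_minus_commute subset_iff)
    qed
    moreover have "seminorm_ball F r \<phi> \<subseteq> V" by (auto simp: seminorm_ball_def)
    ultimately have "seminorm_ball F r \<phi> \<subseteq> {\<phi> \<in> V. u \<phi> \<in> S}" by blast
    moreover have "\<phi> \<in> seminorm_ball F r \<phi>" using centre_mem_seminorm_ball F r \<phi> by simp
    moreover have "openin (seminorm_topology V P) (seminorm_ball F r \<phi>)"
      using openin_seminorm_ball F \<phi> r by simp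
    ultimately show "\<exists>T. openin (seminorm_topology V P) T \<and> \<phi> \<in> T \<and> T \<subseteq> {\<phi> \<in> V. u \<phi> \<in> S}"
      by metis
  qed
  then have "continuous_map (seminorm_topology V P) euclidean u"
    by (auto simp: continuous_map_def topspace_seminorm_topology)
  then show "u \<in> top_dual V P" using R by (simp add: top_dual_def)
qed

text \<open>The filter is arbitrary because two kinds of limits are needed: difference quotients at
  0, and averages of shifts along the naturals.\<close>

lemma top_dual_tendsto:
  assumes u: "u \<in> top_dual V P"
    and mem: "\<forall>\<^sub>F h in G. \<phi> h \<in> V"
    and lim: "\<And>p. p \<in> P \<Longrightarrow> ((\<lambda>h. p (\<phi> h)) \<longlongrightarrow> 0) G"
  shows "((\<lambda>h. u (\<phi> h)) \<longlongrightarrow> 0) G"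
proof -
  obtain F C where F: "finite F" "F \<subseteq> P"
    and bd: "\<And>\<phi>. \<phi> \<in> V \<Longrightarrow> norm (u \<phi>) \<le> C * (\<Sum>p\<in>F. p \<phi>)"
    using top_dual_dominated[OF u] unfolding dominated_def by auto
  have "((\<lambda>h. C * (\<Sum>p\<in>F. p (\<phi> h))) \<longlongrightarrow> C * (\<Sum>p\<in>F. 0)) G"
    using F lim by (intro tendsto_mult tendsto_const tendsto_sum) (auto simp: subset_iff)
  then have *: "((\<lambda>h. C * (\<Sum>p\<in>F. p (\<phi> h))) \<longlongrightarrow> 0) G" by simp
  show ?thesis
    by (rule Lim_null_comparison[OF _ *]) (rule eventually_mono[OF mem bd])
qed

lemma top_dual_lincomb:
  assumes u: "u \<in> top_dual V P" and v: "v \<in> top_dual V P"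
  shows "(\<lambda>\<phi>. a * u \<phi> + b * v \<phi>) \<in> top_dual V P"
  unfolding top_dual_iff
proof (intro conjI allI ballI impI)
  show "a * u \<phi> + b * v \<phi> = 0" if "\<phi> \<notin> V" for \<phi>
    by (simp add: top_dual_outside[OF u that] top_dual_outside[OF v that])
  show "a * u (\<lambda>x. c * \<phi> x + d * \<psi> x) + b * v (\<lambda>x. c * \<phi> x + d * \<psi> x)
      = c * (a * u \<phi> + b * v \<phi>) + d * (a * u \<psi> + b * v \<psi>)"
    if "\<phi> \<in> V" "\<psi> \<in> V" for \<phi> \<psi> c d
    by (simp add: top_dual_linear[OF u that] top_dual_linear[OF v that] algebra_simps)
  have "dominated V P (\<lambda>\<phi>. norm a * norm (u \<phi>) + norm b * norm (v \<phi>))"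
    using u v by (intro dominated_add dominated_mult top_dual_dominated norm_ge_zero)
  then show "dominated V P (\<lambda>\<phi>. norm (a * u \<phi> + b * v \<phi>))"
    by (rule dominated_le) (auto simp: norm_mult intro: norm_triangle_le)
qed

text \<open>The transpose of a linear map between two test spaces. It yields both the distributional
  derivative and the embedding of periodic distributions; the default value 0 keeps the
  normalization outside \<open>V\<close>.\<close>

lemma top_dual_comp:
  assumes W: "seminormed_space W Q" and u: "u \<in> top_dual W Q"
    and mem: "\<And>\<phi>. \<phi> \<in> V \<Longrightarrow> T \<phi> \<in> W"
    and lin: "\<And>\<phi> \<psi> a b. \<phi> \<in> V \<Longrightarrow> \<psi> \<in> V \<Longrightarrow>
      T (\<lambda>x. a * \<phi> x + b * \<psi> x) = (\<lambda>x. a * T \<phi> x + b * T \<psi> x)"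
    and dom: "\<And>q. q \<in> Q \<Longrightarrow> dominated V P (\<lambda>\<phi>. q (T \<phi>))"
  shows "(\<lambda>\<phi>. if \<phi> \<in> V then u (T \<phi>) else 0) \<in> top_dual V P"
proof -
  obtain F C where F: "finite F" "F \<subseteq> Q" "0 \<le> C"
    and bd: "\<And>\<phi>. \<phi> \<in> W \<Longrightarrow> norm (u \<phi>) \<le> C * (\<Sum>q\<in>F. q \<phi>)"
    using seminormed_space.top_dual_dominated[OF W u] unfolding dominated_def by auto
  have "dominated V P (\<lambda>\<phi>. C * (\<Sum>q\<in>F. q (T \<phi>)))"
    using F dom by (intro dominated_mult dominated_sum) auto
  then have "dominated V P (\<lambda>\<phi>. norm (if \<phi> \<in> V then u (T \<phi>) else 0))"
    by (rule dominated_le) (auto intro: bd mem)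
  then show ?thesis
    unfolding top_dual_iff
    by (simp add: lincomb_mem lin mem top_dual_linear[OF u])
qed

end

lemma top_dual_zero: "(\<lambda>\<phi>. 0) \<in> top_dual V P"
  by (auto simp: top_dual_def)

text \<open>A common source of all four spaces: each seminorm is a sup norm after a linear map,
  namely a weighted derivative, a derivative, or the identity.\<close>

lemma seminormed_space_sup_norm:
  fixes T :: "'i \<Rightarrow> ('k::real_normed_field) fn \<Rightarrow> 'k fn"
  assumes "(\<lambda>x. 0) \<in> V"
    and "\<And>\<phi> \<psi> a b. \<phi> \<in> V \<Longrightarrow> \<psi> \<in> V \<Longrightarrow> (\<lambda>x. a * \<phi> x + b * \<psi> x) \<in> V"
    and bd: "\<And>i \<phi>. i \<in> I \<Longrightarrow> \<phi> \<in> V \<Longrightarrow> bounded (range (T i \<phi>))"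
    and lin: "\<And>i \<phi> \<psi> a b. i \<in> I \<Longrightarrow> \<phi> \<in> V \<Longrightarrow> \<psi> \<in> V \<Longrightarrow>
      T i (\<lambda>x. a * \<phi> x + b * \<psi> x) = (\<lambda>x. a * T i \<phi> x + b * T i \<psi> x)"
    and "I \<noteq> {}"
  shows "seminormed_space V ((\<lambda>i \<phi>. sup_norm (T i \<phi>)) ` I)"
proof
  fix p and \<phi> \<psi> :: "'k fn" and a b :: 'k
  assume p: "p \<in> (\<lambda>i \<phi>. sup_norm (T i \<phi>)) ` I" and \<phi>: "\<phi> \<in> V" and \<psi>: "\<psi> \<in> V"
  then obtain i where i: "i \<in> I" "p = (\<lambda>\<phi>. sup_norm (T i \<phi>))" by auto
  have "norm (a * T i \<phi> x + b * T i \<psi> x) \<le> norm a * p \<phi> + norm b * p \<psi>" for x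
    unfolding i using norm_le_sup_norm[OF bd[OF i(1) \<phi>], of x] norm_le_sup_norm[OF bd[OF i(1) \<psi>], of x]
    by (intro norm_triangle_le add_mono) (auto simp: norm_mult intro!: mult_left_mono)
  then show "p (\<lambda>x. a * \<phi> x + b * \<psi> x) \<le> norm a * p \<phi> + norm b * p \<psi>"
    unfolding i(2) lin[OF i(1) \<phi> \<psi>] by (rule sup_norm_le)
qed (use assms in \<open>auto intro: sup_norm_nonneg\<close>)

section \<open>Shifts and derivatives of test functions\<close>

text \<open>Guessing the whole sequence of derivatives at once reduces smoothness and the formula
  for iterated derivatives to one differentiation rule per construction.\<close>

lemma smooth_derivatives:
  assumes "D 0 = \<phi>" and D: "\<And>n x. (D n has_vector_derivative D (Suc n) x) (at x)"
  shows "smooth \<phi>" "(fderiv1 ^^ n) \<phi> = D n"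
proof -
  have *: "(fderiv1 ^^ n) \<phi> = D n" for n
  proof (induction n)
    case (Suc n)
    have "fderiv1 (D n) = D (Suc n)"
      unfolding fderiv1_def using vector_derivative_at[OF D] by blast
    then show ?case using Suc by simp
  qed (simp add: assms(1))
  then show "(fderiv1 ^^ n) \<phi> = D n" .
  show "smooth \<phi>"
    unfolding smooth_def * using D differentiableI_vector by blast
qed

lemma smooth_has_vector_derivative:
  "smooth \<phi> \<Longrightarrow> ((fderiv1 ^^ n) \<phi> has_vector_derivative (fderiv1 ^^ Suc n) \<phi> x) (at x)"
  by (simp add: smooth_def fderiv1_def vector_derivative_works)

lemma smooth_fderiv1: "smooth \<phi> \<Longrightarrow> smooth (fderiv1 \<phi>)"
  unfolding smooth_def by (metis funpow_Suc_right o_apply)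

lemma smooth_lincomb:
  assumes "smooth \<phi>" "smooth \<psi>"
  shows "smooth (\<lambda>x. a * \<phi> x + b * \<psi> x)"
    and "(fderiv1 ^^ n) (\<lambda>x. a * \<phi> x + b * \<psi> x) =
      (\<lambda>x. a * (fderiv1 ^^ n) \<phi> x + b * (fderiv1 ^^ n) \<psi> x)"
proof -
  let ?D = "\<lambda>n x. a * (fderiv1 ^^ n) \<phi> x + b * (fderiv1 ^^ n) \<psi> x"
  have "(?D n has_vector_derivative ?D (Suc n) x) (at x)" for n x
    using assms
    by (intro has_vector_derivative_add has_vector_derivative_mult_right smooth_has_vector_derivative)
  from smooth_derivatives[of ?D, OF _ this]
  show "smooth (\<lambda>x. a * \<phi> x + b * \<psi> x)" "(fderiv1 ^^ n) (\<lambda>x. a * \<phi> x + b * \<psi> x) = ?D n"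
    by simp_all
qed

lemma smooth_shift:
  assumes "smooth \<phi>"
  shows "smooth (\<lambda>x. \<phi> (x + h))"
    and "(fderiv1 ^^ n) (\<lambda>x. \<phi> (x + h)) = (\<lambda>x. (fderiv1 ^^ n) \<phi> (x + h))"
proof -
  let ?D = "\<lambda>n x. (fderiv1 ^^ n) \<phi> (x + h)"
  have "(?D n has_vector_derivative ?D (Suc n) x) (at x)" for n x
  proof -
    have "((\<lambda>x. x + h) has_vector_derivative 1) (at x)"
      by (auto intro!: derivative_eq_intros)
    from vector_diff_chain_at[OF this smooth_has_vector_derivative[OF assms]]
    show ?thesis by (simp add: o_def)
  qed
  from smooth_derivatives[of ?D, OF _ this]
  show "smooth (\<lambda>x. \<phi> (x + h))" "(fderiv1 ^^ n) (\<lambda>x. \<phi> (x + h)) = ?D n"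
    by simp_all
qed

lemma smooth_continuous_on: "smooth \<phi> \<Longrightarrow> continuous_on S \<phi>"
  using smooth_has_vector_derivative[of \<phi> 0]
  by (intro continuous_at_imp_continuous_on) (auto dest: has_vector_derivative_continuous)

lemma smooth_const: "smooth (\<lambda>x. c)" "(fderiv1 ^^ Suc n) (\<lambda>x. c) = (\<lambda>x. 0)"
proof -
  let ?D = "\<lambda>n x::real. if n = 0 then c else 0"
  have *: "(?D n has_vector_derivative ?D (Suc n) x) (at x)" for n x by simp
  from smooth_derivatives(1)[of ?D "\<lambda>x. c", OF _ *]
  show "smooth (\<lambda>x. c)" by simp
  show "(fderiv1 ^^ Suc n) (\<lambda>x. c) = (\<lambda>x. 0)"
    using smooth_derivatives(2)[of ?D "\<lambda>x. c" "Suc n", OF _ *] by simp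
qed

text \<open>The mean value inequality is applied twice, first to \<phi>' and then to \<phi> minus a
  linear function. The bound on \<phi>' is used in its worst case over the ball, which costs the
  usual factor 1/2. Only values of \<phi>'' near \<open>x\<close> enter, so a bound depending on
  \<open>x\<close> is admissible and weights can be carried along.\<close>

lemma norm_taylor_remainder_le:
  fixes \<phi> :: "real \<Rightarrow> 'k::real_normed_field"
  assumes 1: "\<And>x. (\<phi> has_vector_derivative \<phi>' x) (at x)"
    and 2: "\<And>x. (\<phi>' has_vector_derivative \<phi>'' x) (at x)"
    and bd: "\<And>t. \<bar>t\<bar> \<le> \<bar>h\<bar> \<Longrightarrow> norm (\<phi>'' (x + t)) \<le> K"
  shows "norm (\<phi> (x + h) - \<phi> x - h *\<^sub>R \<phi>' x) \<le> K * h\<^sup>2"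
proof -
  let ?S = "cball x \<bar>h\<bar>"
  have K: "0 \<le> K" using order_trans[OF norm_ge_zero bd[of 0]] by simp
  have S: "norm (\<phi>'' y) \<le> K" if "y \<in> ?S" for y
    using bd[of "y - x"] that by (simp add: dist_real_def abs_minus_commute)
  have on: "onorm (\<lambda>t. t *\<^sub>R v) \<le> norm v" for v :: 'k
    by (rule onorm_le) (simp add: mult.commute)
  have d1: "norm (\<phi>' y - \<phi>' x) \<le> K * \<bar>h\<bar>" if y: "y \<in> ?S" for y
  proof -
    have "norm (\<phi>' y - \<phi>' x) \<le> K * norm (y - x)"
    proof (rule differentiable_bound[of ?S \<phi>' "\<lambda>y t. t *\<^sub>R \<phi>'' y"])
      show "(\<phi>' has_derivative (\<lambda>t. t *\<^sub>R \<phi>'' z)) (at z within ?S)" for z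
        using 2[of z] has_derivative_at_withinI unfolding has_vector_derivative_def by blast
      show "onorm (\<lambda>t. t *\<^sub>R \<phi>'' z) \<le> K" if "z \<in> ?S" for z
        using on S[OF that] order_trans by blast
    qed (use y in auto)
    also have "\<dots> \<le> K * \<bar>h\<bar>"
      using y K by (intro mult_left_mono) (auto simp: dist_real_def abs_minus_commute)
    finally show ?thesis .
  qed
  \<comment> \<open>Subtracting the linear part leaves the derivative \<phi>' y - \<phi>' x, which
    has just been bounded by \<open>K * \<bar>h\<bar>\<close>.\<close>
  let ?g = "\<lambda>y. \<phi> y - y *\<^sub>R \<phi>' x"
  have "norm (?g (x + h) - ?g x) \<le> (K * \<bar>h\<bar>) * norm (x + h - x)"
  proof (rule differentiable_bound[of ?S ?g "\<lambda>y t. t *\<^sub>R (\<phi>' y - \<phi>' x)"])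
    show "(?g has_derivative (\<lambda>t. t *\<^sub>R (\<phi>' z - \<phi>' x))) (at z within ?S)" for z
    proof -
      have "(?g has_vector_derivative \<phi>' z - 1 *\<^sub>R \<phi>' x) (at z)"
        by (intro has_vector_derivative_diff 1) (auto intro!: derivative_eq_intros)
      then show ?thesis
        using has_derivative_at_withinI unfolding has_vector_derivative_def by fastforce
    qed
    show "onorm (\<lambda>t. t *\<^sub>R (\<phi>' z - \<phi>' x)) \<le> K * \<bar>h\<bar>" if "z \<in> ?S" for z
      using on d1[OF that] order_trans by blast
  qed (auto simp: dist_real_def)
  moreover have "?g (x + h) - ?g x = \<phi> (x + h) - \<phi> x - h *\<^sub>R \<phi>' x" by (simp add: algebra_simps)
  ultimately show ?thesis by (simp add: power2_eq_square)
qed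

text \<open>What the line and the circle share. The assumption \<open>quotient_tendsto\<close> is
  the analytic core: it lets every continuous functional be differentiated along shifts. The
  assumption \<open>dominated_fderiv1\<close> makes the distributional derivative
  continuous.\<close>

locale test_space = seminormed_space V P
  for V :: "('k::real_normed_field) fn set" and P +
  assumes mem_smooth: "\<phi> \<in> V \<Longrightarrow> smooth \<phi>"
    and shift_mem: "\<phi> \<in> V \<Longrightarrow> (\<lambda>x. \<phi> (x + h)) \<in> V"
    and fderiv1_mem: "\<phi> \<in> V \<Longrightarrow> fderiv1 \<phi> \<in> V"
    and dominated_fderiv1: "p \<in> P \<Longrightarrow> dominated V P (\<lambda>\<phi>. p (fderiv1 \<phi>))"
    and quotient_tendsto: "p \<in> P \<Longrightarrow> \<phi> \<in> V \<Longrightarrow>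
      ((\<lambda>h. p (\<lambda>x. (\<phi> (x + h) - \<phi> x - h *\<^sub>R fderiv1 \<phi> x) /\<^sub>R h)) \<longlongrightarrow> 0) (at 0)"
begin

lemma fderiv1_lincomb:
  "\<phi> \<in> V \<Longrightarrow> \<psi> \<in> V \<Longrightarrow>
   fderiv1 (\<lambda>x. a * \<phi> x + b * \<psi> x) = (\<lambda>x. a * fderiv1 \<phi> x + b * fderiv1 \<psi> x)"
  using smooth_lincomb(2)[of \<phi> \<psi> 1] mem_smooth by simp

lemma distr_deriv_mem:
  assumes "u \<in> top_dual V P" shows "distr_deriv V u \<in> top_dual V P"
proof -
  have "(\<lambda>\<phi>. if \<phi> \<in> V then u (fderiv1 \<phi>) else 0) \<in> top_dual V P"
    using fderiv1_mem fderiv1_lincomb dominated_fderiv1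
    by (intro top_dual_comp[OF seminormed_space_axioms assms])
  from top_dual_lincomb[OF this this, of "-1" 0]
  moreover have "(\<lambda>\<phi>. - 1 * (if \<phi> \<in> V then u (fderiv1 \<phi>) else 0) + 0 * (if \<phi> \<in> V then u (fderiv1 \<phi>) else 0))
      = distr_deriv V u" by (auto simp: distr_deriv_def fun_eq_iff)
  ultimately show ?thesis by simp
qed

lemma has_vector_derivative_shift:
  assumes u: "u \<in> top_dual V P" and \<phi>: "\<phi> \<in> V"
  shows "((\<lambda>h. u (\<lambda>x. \<phi> (x + h))) has_vector_derivative u (\<lambda>x. fderiv1 \<phi> (x + h))) (at h)"
proof -
  define \<psi> where "\<psi> = (\<lambda>x. \<phi> (x + h))"
  have \<psi>: "\<psi> \<in> V" using shift_mem[OF \<phi>] by (simp add: \<psi>_def)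
  have d\<psi>: "fderiv1 \<psi> = (\<lambda>x. fderiv1 \<phi> (x + h))"
    using smooth_shift(2)[OF mem_smooth[OF \<phi>], of 1] by (simp add: \<psi>_def)
  let ?q = "\<lambda>k x. (\<psi> (x + k) - \<psi> x - k *\<^sub>R fderiv1 \<psi> x) /\<^sub>R k"
  \<comment> \<open>The quotient is split into the shifted function \<open>g k\<close> and the
    first-order Taylor polynomial \<open>f k\<close>, so that two-term linearity of \<open>u\<close>
    suffices. The identity \<open>qf\<close> also holds at k = 0, where the inverse is 0.\<close>
  define f where "f k = (\<lambda>x. 1 * \<psi> x + of_real k * fderiv1 \<psi> x)" for k
  define g where "g k = (\<lambda>x. \<psi> (x + k))" for k
  have f: "f k \<in> V" for k
    unfolding f_def using lincomb_mem[of \<psi> "fderiv1 \<psi>" 1 "of_real k"] \<psi> fderiv1_mem by blast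
  have g: "g k \<in> V" for k unfolding g_def using shift_mem[OF \<psi>] by blast
  have qf: "?q k = (\<lambda>x. of_real (inverse k) * g k x + (- of_real (inverse k)) * f k x)" for k
    by (simp add: fun_eq_iff f_def g_def scaleR_conv_of_real algebra_simps)
  have uf: "u (f k) = u \<psi> + k *\<^sub>R u (fderiv1 \<psi>)" for k
    using top_dual_linear[OF u \<psi> fderiv1_mem[OF \<psi>], of 1 "of_real k"]
    by (simp add: f_def scaleR_conv_of_real)
  have uq: "u (?q k) = (u (\<lambda>x. \<psi> (x + k)) - u \<psi> - k *\<^sub>R u (fderiv1 \<psi>)) /\<^sub>R k" for k
  proof -
    have "u (?q k) = of_real (inverse k) * u (g k) + (- of_real (inverse k)) * u (f k)"
      unfolding qf using top_dual_linear[OF u g f] by blast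
    then show ?thesis
      unfolding uf by (simp add: g_def scaleR_conv_of_real algebra_simps)
  qed
  have "?q k \<in> V" for k unfolding qf using lincomb_mem[OF g f] by blast
  then have "((\<lambda>k. u (?q k)) \<longlongrightarrow> 0) (at 0)"
    using quotient_tendsto[OF _ \<psi>] by (intro top_dual_tendsto[OF u]) auto
  from tendsto_norm_zero[OF this]
  have "((\<lambda>k. norm (u (\<lambda>x. \<psi> (x + k)) - u \<psi> - k *\<^sub>R u (fderiv1 \<psi>)) / norm k) \<longlongrightarrow> 0) (at 0)"
    unfolding uq by (simp add: divide_inverse mult.commute)
  then show ?thesis
    unfolding has_vector_derivative_def has_derivative_at \<psi>_def[symmetric] d\<psi>[symmetric]
    using bounded_linear_scaleR_left by (simp add: \<psi>_def algebra_simps)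
qed

lemma shift_invariant_imp_deriv_zero:
  assumes u: "u \<in> top_dual V P" and inv: "\<And>h. u (\<lambda>x. \<phi> (x + h)) = u \<phi>" and \<phi>: "\<phi> \<in> V"
  shows "u (fderiv1 \<phi>) = 0"
proof -
  have "((\<lambda>h. u \<phi>) has_vector_derivative u (fderiv1 \<phi>)) (at 0)"
    using has_vector_derivative_shift[OF u \<phi>, of 0] by (simp add: inv)
  then show ?thesis using vector_derivative_unique_at has_vector_derivative_const by blast
qed

text \<open>The function \<open>h \<mapsto> u (\<phi> (\<cdot> + h))\<close> is affine with slope \<open>c\<close> and agrees at 0 and at 1.\<close>
lemma periodic_deriv_constant_imp_zero:
  assumes u: "u \<in> top_dual V P" and \<phi>: "\<phi> \<in> V"
    and per: "u (\<lambda>x. \<phi> (x + 1)) = u \<phi>"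
    and const: "\<And>h. u (\<lambda>x. fderiv1 \<phi> (x + h)) = c"
  shows "c = 0"
proof -
  let ?g = "\<lambda>h. u (\<lambda>x. \<phi> (x + h)) - h *\<^sub>R c"
  have "(?g has_vector_derivative c - 1 *\<^sub>R c) (at h)" for h
    using has_vector_derivative_shift[OF u \<phi>, of h] unfolding const
    by (intro has_vector_derivative_diff) (auto intro!: derivative_eq_intros)
  then have "(?g has_derivative (\<lambda>t. 0)) (at h within UNIV)" for h
    unfolding has_vector_derivative_def by simp
  then have "?g 1 = ?g 0" using has_derivative_zero_unique[of UNIV ?g 1 0] by simp
  then show ?thesis using per by simp
qed

lemma deriv_zero_imp_shift_invariant:
  assumes u: "u \<in> top_dual V P" and D: "\<And>\<psi>. \<psi> \<in> V \<Longrightarrow> u (fderiv1 \<psi>) = 0" and \<phi>: "\<phi> \<in> V"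
  shows "u (\<lambda>x. \<phi> (x + h)) = u \<phi>"
proof -
  have "fderiv1 (\<lambda>x. \<phi> (x + h)) = (\<lambda>x. fderiv1 \<phi> (x + h))" for h
    using smooth_shift(2)[OF mem_smooth[OF \<phi>], of 1] by simp
  then have "u (\<lambda>x. fderiv1 \<phi> (x + h)) = 0" for h
    using D[OF shift_mem[OF \<phi>, of h]] by simp
  then have "((\<lambda>h. u (\<lambda>x. \<phi> (x + h))) has_derivative (\<lambda>t. 0)) (at h within UNIV)" for h
    using has_vector_derivative_shift[OF u \<phi>, of h] unfolding has_vector_derivative_def by simp
  then have "(\<lambda>h. u (\<lambda>x. \<phi> (x + h))) h = (\<lambda>h. u (\<lambda>x. \<phi> (x + h))) 0"
    using has_derivative_zero_unique[of UNIV "\<lambda>h. u (\<lambda>x. \<phi> (x + h))" h 0] by simp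
  then show ?thesis by simp
qed

text \<open>Equality of functionals also ranges over functions outside \<open>V\<close>. There both
  sides have the default value 0, because \<open>V\<close> is invariant under the opposite shift as
  well.\<close>

lemma translate_eq_iff:
  assumes "u \<in> top_dual V P"
  shows "translate h u = u \<longleftrightarrow> (\<forall>\<phi>\<in>V. u (\<lambda>x. \<phi> (x + h)) = u \<phi>)"
proof
  assume R: "\<forall>\<phi>\<in>V. u (\<lambda>x. \<phi> (x + h)) = u \<phi>"
  have "u (\<lambda>x. \<phi> (x + h)) = u \<phi>" if "\<phi> \<notin> V" for \<phi>
  proof -
    have "(\<lambda>x. \<phi> (x + h)) \<notin> V"
      using shift_mem[of "\<lambda>x. \<phi> (x + h)" "- h"] that by auto
    then show ?thesis using top_dual_outside[OF assms] that by simp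
  qed
  then show "translate h u = u" using R by (auto simp: translate_def fun_eq_iff)
qed (auto simp: translate_def fun_eq_iff)

lemma distr_deriv_eq_zero_iff:
  assumes "u \<in> top_dual V P"
  shows "distr_deriv V u = (\<lambda>\<phi>. 0) \<longleftrightarrow> (\<forall>h. translate h u = u)"
proof
  assume "distr_deriv V u = (\<lambda>\<phi>. 0)"
  then have "u (fderiv1 \<psi>) = 0" if "\<psi> \<in> V" for \<psi>
    using that by (auto simp: distr_deriv_def fun_eq_iff dest!: spec[of _ \<psi>])
  then show "\<forall>h. translate h u = u"
    using deriv_zero_imp_shift_invariant[OF assms] translate_eq_iff[OF assms] by blast
next
  assume "\<forall>h. translate h u = u"
  then have "u (fderiv1 \<phi>) = 0" if "\<phi> \<in> V" for \<phi>
    using shift_invariant_imp_deriv_zero[OF assms _ that] translate_eq_iff[OF assms] that by blast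
  then show "distr_deriv V u = (\<lambda>\<phi>. 0)" by (auto simp: distr_deriv_def)
qed

lemma translate_distr_deriv:
  assumes u: "u \<in> top_dual V P" and "translate h u = u"
  shows "translate h (distr_deriv V u) = distr_deriv V u"
  unfolding translate_eq_iff[OF distr_deriv_mem[OF u]]
proof
  fix \<phi> assume \<phi>: "\<phi> \<in> V"
  have "fderiv1 (\<lambda>x. \<phi> (x + h)) = (\<lambda>x. fderiv1 \<phi> (x + h))"
    using smooth_shift(2)[OF mem_smooth[OF \<phi>], of 1] by simp
  then show "distr_deriv V u (\<lambda>x. \<phi> (x + h)) = distr_deriv V u \<phi>"
    using assms(2) \<phi> fderiv1_mem[OF \<phi>] shift_mem[OF \<phi>]
    by (simp add: distr_deriv_def translate_eq_iff[OF u])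
qed

text \<open>By induction, applied to v = D u, the functional v is shift invariant. Hence
  \<open>u\<close> on the shifts of a test function \<phi> is affine in the shift, with slope - v
  \<phi>. Periodicity of \<open>u\<close> makes this slope 0, so that v itself vanishes.\<close>

lemma periodic_distr_deriv_funpow_zero:
  assumes "u \<in> top_dual V P" "translate 1 u = u" "(distr_deriv V ^^ Suc n) u = (\<lambda>\<phi>. 0)"
  shows "distr_deriv V u = (\<lambda>\<phi>. 0)"
  using assms
proof (induction n arbitrary: u)
  case (Suc n)
  define v where "v = distr_deriv V u"
  have v: "v \<in> top_dual V P" unfolding v_def using Suc.prems(1) by (rule distr_deriv_mem)
  have "translate 1 v = v"
    unfolding v_def using Suc.prems by (intro translate_distr_deriv)
  moreover have "(distr_deriv V ^^ Suc n) v = (\<lambda>\<phi>. 0)"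
    using Suc.prems(3) unfolding v_def by (simp only: funpow_Suc_right o_apply)
  ultimately have "distr_deriv V v = (\<lambda>\<phi>. 0)" using Suc.IH v by blast
  then have inv: "v (\<lambda>x. \<phi> (x + h)) = v \<phi>" if "\<phi> \<in> V" for h \<phi>
    using distr_deriv_eq_zero_iff[OF v] translate_eq_iff[OF v] that by blast
  have "v \<phi> = 0" if \<phi>: "\<phi> \<in> V" for \<phi>
  proof -
    have "u (\<lambda>x. fderiv1 \<phi> (x + h)) = - v \<phi>" for h
    proof -
      have "fderiv1 (\<lambda>x. \<phi> (x + h)) = (\<lambda>x. fderiv1 \<phi> (x + h))"
        using smooth_shift(2)[OF mem_smooth[OF \<phi>], of 1] by simp
      then have "v (\<lambda>x. \<phi> (x + h)) = - u (\<lambda>x. fderiv1 \<phi> (x + h))"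
        using shift_mem[OF \<phi>, of h] by (simp add: v_def distr_deriv_def)
      then show ?thesis using inv[OF \<phi>, of h] by simp
    qed
    moreover have "u (\<lambda>x. \<phi> (x + 1)) = u \<phi>"
      using Suc.prems(1,2) \<phi> translate_eq_iff by blast
    ultimately show ?thesis
      using periodic_deriv_constant_imp_zero[OF Suc.prems(1) \<phi>] by fastforce
  qed
  then have "v \<phi> = 0" for \<phi> using top_dual_outside[OF v] by blast
  then show ?case by (auto simp: v_def)
qed simp

end

section \<open>Test functions on the line and on the circle\<close>

definition seminorms_R :: "(('k::real_normed_field) fn \<Rightarrow> real) set" where
  "seminorms_R = range (\<lambda>(m, n) \<phi>. sup_norm (\<lambda>x. x ^ m *\<^sub>R (fderiv1 ^^ n) \<phi> x))"

definition seminorms_T :: "(('k::real_normed_field) fn \<Rightarrow> real) set" where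
  "seminorms_T = range (\<lambda>n \<phi>. sup_norm ((fderiv1 ^^ n) \<phi>))"

lemma seminorms_R_I: "(\<lambda>\<phi>. sup_norm (\<lambda>x. x ^ m *\<^sub>R (fderiv1 ^^ n) \<phi> x)) \<in> seminorms_R"
  unfolding seminorms_R_def by (rule image_eqI[of _ _ "(m, n)"]) auto

lemma seminorms_T_I: "(\<lambda>\<phi>. sup_norm ((fderiv1 ^^ n) \<phi>)) \<in> seminorms_T"
  unfolding seminorms_T_def by blast

lemma tempered_R_eq: "tempered_R = top_dual schwartz_R seminorms_R"
  by (simp add: tempered_R_def seminorms_R_def)

lemma distributions_T_eq: "distributions_T = top_dual schwartz_T seminorms_T"
  by (simp add: distributions_T_def seminorms_T_def)

lemma bounded_range_lincomb:
  fixes f g :: "'a \<Rightarrow> 'k::real_normed_field"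
  assumes "bounded (range f)" "bounded (range g)"
  shows "bounded (range (\<lambda>x. a * f x + b * g x))"
proof -
  obtain B C where "\<And>x. norm (f x) \<le> B" "\<And>x. norm (g x) \<le> C"
    using assms by (auto simp: bounded_iff)
  then have "norm (a * f x + b * g x) \<le> norm a * B + norm b * C" for x
    by (intro norm_triangle_le add_mono) (simp_all add: norm_mult mult_left_mono)
  then show ?thesis by (auto simp: bounded_iff)
qed

lemma bounded_range_schwartz_R:
  "\<phi> \<in> schwartz_R \<Longrightarrow> bounded (range (\<lambda>x. x ^ m *\<^sub>R (fderiv1 ^^ n) \<phi> x))"
  by (simp add: schwartz_R_def)

lemma funpow_fderiv1: "(fderiv1 ^^ n) (fderiv1 \<phi>) = (fderiv1 ^^ Suc n) \<phi>"
  by (simp only: funpow_Suc_right o_apply)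

lemma schwartz_R_lincomb:
  assumes "\<phi> \<in> schwartz_R" "\<psi> \<in> schwartz_R"
  shows "(\<lambda>x. a * \<phi> x + b * \<psi> x) \<in> schwartz_R"
proof -
  have sm: "smooth \<phi>" "smooth \<psi>" using assms by (simp_all add: schwartz_R_def)
  have "bounded (range (\<lambda>x. x ^ m *\<^sub>R (fderiv1 ^^ n) (\<lambda>x. a * \<phi> x + b * \<psi> x) x))" for m n
    using bounded_range_lincomb[OF bounded_range_schwartz_R[OF assms(1), of m n]
        bounded_range_schwartz_R[OF assms(2), of m n], of a b]
    by (simp add: smooth_lincomb(2)[OF sm] scaleR_add_right)
  then show ?thesis using smooth_lincomb(1)[OF sm] by (simp add: schwartz_R_def)
qed

text \<open>The factor \<open>2 ^ m\<close> comes from \<bar>x\<bar> \<le> 2 max(\<bar>x + h\<bar>,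
  \<bar>h\<bar>), and the power of the maximum is at most the sum of the powers. The exponent
  \<open>x ^ 0\<close> is kept so that the right-hand side is literally built from members of
  \<open>seminorms_R\<close>.\<close>

lemma norm_schwartz_R_shift_le:
  assumes \<phi>: "\<phi> \<in> schwartz_R"
  shows "\<bar>x\<bar> ^ m * norm ((fderiv1 ^^ n) \<phi> (x + h)) \<le>
    2 ^ m * (sup_norm (\<lambda>x. x ^ m *\<^sub>R (fderiv1 ^^ n) \<phi> x)
      + \<bar>h\<bar> ^ m * sup_norm (\<lambda>x. x ^ 0 *\<^sub>R (fderiv1 ^^ n) \<phi> x))"
proof -
  let ?N = "norm ((fderiv1 ^^ n) \<phi> (x + h))"
  let ?M = "max \<bar>x + h\<bar> \<bar>h\<bar>"
  have "\<bar>x\<bar> \<le> 2 * ?M" by (simp add: max_def abs_if)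
  then have "\<bar>x\<bar> ^ m \<le> (2 * ?M) ^ m" by (rule power_mono) simp
  also have "\<dots> \<le> 2 ^ m * (\<bar>x + h\<bar> ^ m + \<bar>h\<bar> ^ m)"
    by (auto simp: power_mult_distrib max_def)
  finally have "\<bar>x\<bar> ^ m * ?N \<le> 2 ^ m * (\<bar>x + h\<bar> ^ m + \<bar>h\<bar> ^ m) * ?N"
    by (rule mult_right_mono) simp
  also have "\<dots> = 2 ^ m * (\<bar>x + h\<bar> ^ m * ?N + \<bar>h\<bar> ^ m * ?N)" by (simp add: algebra_simps)
  also have "\<dots> \<le> 2 ^ m * (sup_norm (\<lambda>x. x ^ m *\<^sub>R (fderiv1 ^^ n) \<phi> x)
      + \<bar>h\<bar> ^ m * sup_norm (\<lambda>x. x ^ 0 *\<^sub>R (fderiv1 ^^ n) \<phi> x))"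
    using norm_le_sup_norm[OF bounded_range_schwartz_R[OF \<phi>, of m n], of "x + h"]
      norm_le_sup_norm[OF bounded_range_schwartz_R[OF \<phi>, of 0 n], of "x + h"]
    by (intro mult_left_mono add_mono) (simp_all add: power_abs)
  finally show ?thesis .
qed

lemma smooth_quotient:
  assumes "smooth \<phi>"
  shows "(fderiv1 ^^ n) (\<lambda>x. (\<phi> (x + h) - \<phi> x - h *\<^sub>R fderiv1 \<phi> x) /\<^sub>R h) =
    (\<lambda>x. ((fderiv1 ^^ n) \<phi> (x + h) - (fderiv1 ^^ n) \<phi> x - h *\<^sub>R (fderiv1 ^^ Suc n) \<phi> x) /\<^sub>R h)"
proof -
  let ?D = "\<lambda>n x. ((fderiv1 ^^ n) \<phi> (x + h) - (fderiv1 ^^ n) \<phi> x - h *\<^sub>R (fderiv1 ^^ Suc n) \<phi> x) /\<^sub>R h"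
  have sh: "((\<lambda>x. (fderiv1 ^^ n) \<phi> (x + h)) has_vector_derivative (fderiv1 ^^ Suc n) \<phi> (x + h)) (at x)" for n x
    using smooth_has_vector_derivative[OF smooth_shift(1)[OF assms, of h], of n x]
    unfolding smooth_shift(2)[OF assms] .
  have "(?D n has_vector_derivative ?D (Suc n) x) (at x)" for n x
    by (intro has_vector_derivative_diff sh smooth_has_vector_derivative assms
        bounded_linear.has_vector_derivative[OF bounded_linear_scaleR_right])
  from smooth_derivatives(2)[of ?D, OF _ this] show ?thesis by simp
qed

text \<open>At a fixed point the weight is a constant, so the Taylor estimate applies with
  \<open>K = C / \<bar>x\<bar> ^ m\<close>; dividing the remainder by \<open>h\<close> leaves one
  factor \<bar>h\<bar>. If the weight or \<open>h\<close> is 0, the left-hand side is 0, the latter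
  because the inverse of 0 is 0.\<close>

lemma norm_quotient_le:
  assumes sm: "smooth \<phi>"
    and bd: "\<And>t. \<bar>t\<bar> \<le> \<bar>h\<bar> \<Longrightarrow> \<bar>x\<bar> ^ m * norm ((fderiv1 ^^ Suc (Suc n)) \<phi> (x + t)) \<le> C"
  shows "norm (x ^ m *\<^sub>R (fderiv1 ^^ n) (\<lambda>x. (\<phi> (x + h) - \<phi> x - h *\<^sub>R fderiv1 \<phi> x) /\<^sub>R h) x) \<le> C * \<bar>h\<bar>"
proof (cases "x ^ m = 0 \<or> h = 0")
  case True
  have "0 \<le> \<bar>x\<bar> ^ m * norm ((fderiv1 ^^ Suc (Suc n)) \<phi> (x + 0))" by simp
  also have "\<dots> \<le> C" by (rule bd) simp
  finally have "0 \<le> C" .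
  from True show ?thesis
  proof
    assume "x ^ m = 0"
    then show ?thesis using \<open>0 \<le> C\<close> by (simp only: scaleR_zero_left norm_zero) simp
  next
    assume "h = 0"
    then show ?thesis unfolding smooth_quotient[OF sm] by simp
  qed
next
  case False
  then have pos: "0 < \<bar>x\<bar> ^ m" "0 < \<bar>h\<bar>" by (auto simp: power_abs[symmetric])
  let ?r = "(fderiv1 ^^ n) \<phi> (x + h) - (fderiv1 ^^ n) \<phi> x - h *\<^sub>R (fderiv1 ^^ Suc n) \<phi> x"
  have "norm ((fderiv1 ^^ Suc (Suc n)) \<phi> (x + t)) \<le> C / \<bar>x\<bar> ^ m" if "\<bar>t\<bar> \<le> \<bar>h\<bar>" for t
    using bd[OF that] pos(1) by (simp only: pos_le_divide_eq mult.commute)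
  then have "norm ?r \<le> (C / \<bar>x\<bar> ^ m) * h\<^sup>2"
    by (rule norm_taylor_remainder_le[OF smooth_has_vector_derivative[OF sm] smooth_has_vector_derivative[OF sm]])
  also have "h\<^sup>2 = \<bar>h\<bar> * \<bar>h\<bar>" by (simp add: power2_eq_square)
  finally have "\<bar>x\<bar> ^ m * (norm ?r / \<bar>h\<bar>) \<le> C * \<bar>h\<bar>"
    using pos by (simp add: field_simps)
  then show ?thesis
    unfolding smooth_quotient[OF sm] by (simp add: power_abs abs_mult divide_inverse mult_ac)
qed

lemma sup_norm_tendsto_zero:
  assumes "\<forall>\<^sub>F h in F. \<forall>x. norm (f h x) \<le> g h" "(g \<longlongrightarrow> 0) F"
  shows "((\<lambda>h. sup_norm (f h)) \<longlongrightarrow> 0) F"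
proof (rule Lim_null_comparison[OF _ assms(2)])
  show "\<forall>\<^sub>F h in F. norm (sup_norm (f h)) \<le> g h"
    using assms(1)
  proof eventually_elim
    case (elim h)
    then have "bounded (range (f h))" by (auto simp: bounded_iff)
    then have "0 \<le> sup_norm (f h)" by (rule sup_norm_nonneg)
    moreover have "sup_norm (f h) \<le> g h" using elim by (intro sup_norm_le) auto
    ultimately show ?case by simp
  qed
qed

lemma eventually_abs_le_one: "\<forall>\<^sub>F h::real in at 0. \<bar>h\<bar> \<le> 1"
  unfolding eventually_at by (auto intro!: exI[of _ 1])

lemma tendsto_mult_abs_zero: "((\<lambda>h::real. C * \<bar>h\<bar>) \<longlongrightarrow> 0) (at 0)"
  by (auto intro!: tendsto_eq_intros)

interpretation R: test_space schwartz_R seminorms_R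
proof -
  have lin: "smooth \<phi> \<Longrightarrow> smooth \<psi> \<Longrightarrow> (\<lambda>x. x ^ m *\<^sub>R (fderiv1 ^^ n) (\<lambda>x. a * \<phi> x + b * \<psi> x) x) =
      (\<lambda>x. a * (x ^ m *\<^sub>R (fderiv1 ^^ n) \<phi> x) + b * (x ^ m *\<^sub>R (fderiv1 ^^ n) \<psi> x))"
    for \<phi> \<psi> :: "'a fn" and a b m n
    by (simp add: smooth_lincomb(2) scaleR_add_right)
  have zero: "(\<lambda>x. 0) \<in> (schwartz_R :: 'a fn set)"
  proof -
    have "(fderiv1 ^^ n) (\<lambda>x. 0) = (\<lambda>x. 0::'a)" for n
      using smooth_const(2)[of _ "0::'a"] by (cases n) auto
    then show ?thesis by (simp add: schwartz_R_def smooth_const(1) image_constant_conv)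
  qed
  let ?T = "\<lambda>(m, n) (\<phi>::'a fn) x. x ^ m *\<^sub>R (fderiv1 ^^ n) \<phi> x"
  have "seminormed_space schwartz_R ((\<lambda>i \<phi>. sup_norm (?T i \<phi>)) ` UNIV)"
    by (rule seminormed_space_sup_norm)
      (auto simp: zero schwartz_R_lincomb bounded_range_schwartz_R, auto simp: lin schwartz_R_def)
  also have "((\<lambda>i \<phi>. sup_norm (?T i \<phi>)) ` UNIV) = seminorms_R"
    unfolding seminorms_R_def by (rule image_cong) auto
  finally interpret S: seminormed_space schwartz_R "seminorms_R :: ('a fn \<Rightarrow> real) set" .
  show "test_space schwartz_R (seminorms_R :: ('a fn \<Rightarrow> real) set)"
  proof
    fix \<phi> :: "'a fn" assume \<phi>: "\<phi> \<in> schwartz_R"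
    then show sm: "smooth \<phi>" by (simp add: schwartz_R_def)
    show "(\<lambda>x. \<phi> (x + h)) \<in> schwartz_R" for h
    proof -
      have "bounded (range (\<lambda>x. x ^ m *\<^sub>R (fderiv1 ^^ n) \<phi> (x + h)))" for m n
        unfolding bounded_iff
        using norm_schwartz_R_shift_le[OF \<phi>, of _ m n h] by (auto simp: power_abs)
      then show ?thesis
        unfolding schwartz_R_def using smooth_shift[OF sm] by simp
    qed
    show "fderiv1 \<phi> \<in> schwartz_R"
    proof -
      have "bounded (range (\<lambda>x. x ^ m *\<^sub>R (fderiv1 ^^ n) (fderiv1 \<phi>) x))" for m n
        unfolding funpow_fderiv1 by (rule bounded_range_schwartz_R[OF \<phi>])
      then show ?thesis using smooth_fderiv1[OF sm] by (simp add: schwartz_R_def)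
    qed
  next
    fix p :: "'a fn \<Rightarrow> real" assume "p \<in> seminorms_R"
    then obtain m n where p: "p = (\<lambda>\<phi>. sup_norm (\<lambda>x. x ^ m *\<^sub>R (fderiv1 ^^ n) \<phi> x))"
      by (auto simp: seminorms_R_def)
    show "dominated schwartz_R seminorms_R (\<lambda>\<phi>. p (fderiv1 \<phi>))"
      unfolding p funpow_fderiv1 by (rule S.dominated_mem[OF seminorms_R_I])
    fix \<phi> :: "'a fn" assume \<phi>: "\<phi> \<in> schwartz_R"
    then have sm: "smooth \<phi>" by (simp add: schwartz_R_def)
    define A B where "A = sup_norm (\<lambda>x. x ^ m *\<^sub>R (fderiv1 ^^ Suc (Suc n)) \<phi> x)"
      and "B = sup_norm (\<lambda>x. x ^ 0 *\<^sub>R (fderiv1 ^^ Suc (Suc n)) \<phi> x)"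
    have B: "0 \<le> B" unfolding B_def by (rule sup_norm_nonneg[OF bounded_range_schwartz_R[OF \<phi>]])
    \<comment> \<open>This is the shift estimate with \<bar>t\<bar> ^ m replaced by its bound 1,
      hence uniform in shifts of length at most 1. Two further derivatives are taken because the
      Taylor remainder is controlled by the second derivative.\<close>
    let ?C = "2 ^ m * (A + B)"
    have "\<bar>x\<bar> ^ m * norm ((fderiv1 ^^ Suc (Suc n)) \<phi> (x + t)) \<le> ?C" if "\<bar>t\<bar> \<le> 1" for x t
    proof -
      have "\<bar>t\<bar> ^ m * B \<le> 1 * B" using that B by (intro mult_right_mono power_le_one) auto
      then have "2 ^ m * (A + \<bar>t\<bar> ^ m * B) \<le> ?C" by simp
      then show ?thesis
        using norm_schwartz_R_shift_le[OF \<phi>, of x m "Suc (Suc n)" t] unfolding A_def B_def by linarith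
    qed
    then have "\<forall>\<^sub>F h in at 0. \<forall>x. norm (x ^ m *\<^sub>R
        (fderiv1 ^^ n) (\<lambda>x. (\<phi> (x + h) - \<phi> x - h *\<^sub>R fderiv1 \<phi> x) /\<^sub>R h) x) \<le> ?C * \<bar>h\<bar>"
      by (intro eventually_mono[OF eventually_abs_le_one] allI norm_quotient_le[OF sm])
        (meson order_trans)
    then show "((\<lambda>h. p (\<lambda>x. (\<phi> (x + h) - \<phi> x - h *\<^sub>R fderiv1 \<phi> x) /\<^sub>R h)) \<longlongrightarrow> 0) (at 0)"
      unfolding p by (rule sup_norm_tendsto_zero) (rule tendsto_mult_abs_zero)
  qed
qed

section \<open>Periodic test functions\<close>

lemma periodic1_of_int:
  assumes "periodic1 \<phi>" shows "\<phi> (x + of_int k) = \<phi> x"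
proof -
  have nat: "\<phi> (x + of_nat n) = \<phi> x" for x n
  proof (induction n)
    case (Suc n)
    have "\<phi> (x + of_nat n + 1) = \<phi> (x + of_nat n)" using assms unfolding periodic1_def by blast
    then show ?case using Suc by (simp add: add_ac)
  qed simp
  show ?thesis
  proof (cases k)
    case (nonneg n)
    then show ?thesis using nat by simp
  next
    case (neg n)
    then have "x + of_int k + of_nat (Suc n) = x" by simp
    then show ?thesis using nat[of "x + of_int k" "Suc n"] by metis
  qed
qed

lemma bounded_range_periodic1:
  assumes "continuous_on UNIV \<phi>" "periodic1 \<phi>"
  shows "bounded (range \<phi>)"
proof -
  have "\<phi> x \<in> \<phi> ` {0..1}" for x
  proof (rule image_eqI)
    show "\<phi> x = \<phi> (frac x)"
      using periodic1_of_int[OF assms(2), of "frac x" "\<lfloor>x\<rfloor>"] by (simp add: frac_def)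
    show "frac x \<in> {0..1}" using frac_lt_1[of x] by (simp add: less_imp_le)
  qed
  moreover have "bounded (\<phi> ` {0..1})"
    by (rule compact_imp_bounded[OF compact_continuous_image[OF continuous_on_subset[OF assms(1)]]]) simp_all
  ultimately show ?thesis by (meson bounded_subset image_subsetI)
qed

lemma periodic1_lincomb: "periodic1 \<phi> \<Longrightarrow> periodic1 \<psi> \<Longrightarrow> periodic1 (\<lambda>x. a * \<phi> x + b * \<psi> x)"
  by (simp add: periodic1_def)

lemma periodic1_funpow_fderiv1:
  assumes "smooth \<phi>" "periodic1 \<phi>" shows "periodic1 ((fderiv1 ^^ n) \<phi>)"
proof -
  have "(\<lambda>x. \<phi> (x + 1)) = \<phi>" using assms(2) by (simp add: periodic1_def)
  then have "(\<lambda>x. (fderiv1 ^^ n) \<phi> (x + 1)) = (fderiv1 ^^ n) \<phi>"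
    using smooth_shift(2)[OF assms(1), of n 1] by simp
  then show ?thesis unfolding periodic1_def by metis
qed

lemma smooth_funpow_fderiv1: "smooth \<phi> \<Longrightarrow> smooth ((fderiv1 ^^ n) \<phi>)"
  by (induction n) (auto intro: smooth_fderiv1)

lemma bounded_range_schwartz_T: "\<phi> \<in> schwartz_T \<Longrightarrow> bounded (range ((fderiv1 ^^ n) \<phi>))"
  by (auto simp: schwartz_T_def
      intro!: bounded_range_periodic1 periodic1_funpow_fderiv1 smooth_continuous_on smooth_funpow_fderiv1)

interpretation T: test_space schwartz_T seminorms_T
proof -
  let ?T = "\<lambda>n. fderiv1 ^^ n :: 'a fn \<Rightarrow> 'a fn"
  have "seminormed_space schwartz_T ((\<lambda>i \<phi>. sup_norm (?T i \<phi>)) ` UNIV)"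
    by (rule seminormed_space_sup_norm)
      (auto simp: bounded_range_schwartz_T, auto simp: schwartz_T_def smooth_lincomb smooth_const
        periodic1_lincomb periodic1_def)
  then interpret S: seminormed_space schwartz_T "seminorms_T :: ('a fn \<Rightarrow> real) set"
    by (simp add: seminorms_T_def)
  show "test_space schwartz_T (seminorms_T :: ('a fn \<Rightarrow> real) set)"
  proof
    fix \<phi> :: "'a fn" assume \<phi>: "\<phi> \<in> schwartz_T"
    then show sm: "smooth \<phi>" by (simp add: schwartz_T_def)
    have "\<phi> (x + 1) = \<phi> x" for x using \<phi> by (simp add: schwartz_T_def periodic1_def)
    then have "\<phi> (x + 1 + h) = \<phi> (x + h)" for x h by (metis add.assoc add.commute)
    then show "(\<lambda>x. \<phi> (x + h)) \<in> schwartz_T" for h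
      using smooth_shift(1)[OF sm] by (simp add: schwartz_T_def periodic1_def)
    show "fderiv1 \<phi> \<in> schwartz_T"
      using \<phi> smooth_fderiv1[OF sm] periodic1_funpow_fderiv1[of \<phi> 1] by (simp add: schwartz_T_def)
  next
    fix p :: "'a fn \<Rightarrow> real" assume "p \<in> seminorms_T"
    then obtain n where p: "p = (\<lambda>\<phi>. sup_norm ((fderiv1 ^^ n) \<phi>))"
      by (auto simp: seminorms_T_def)
    show "dominated schwartz_T seminorms_T (\<lambda>\<phi>. p (fderiv1 \<phi>))"
      unfolding p funpow_fderiv1 by (rule S.dominated_mem[OF seminorms_T_I])
    fix \<phi> :: "'a fn" assume \<phi>: "\<phi> \<in> schwartz_T"
    then have sm: "smooth \<phi>" by (simp add: schwartz_T_def)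
    let ?C = "sup_norm ((fderiv1 ^^ Suc (Suc n)) \<phi>)"
    \<comment> \<open>The estimate for the line is reused with weight exponent 0; a sup norm does
      not change under shifts, so \<open>?C\<close> needs no extra factor.\<close>
    have "\<bar>x\<bar> ^ 0 * norm ((fderiv1 ^^ Suc (Suc n)) \<phi> (x + t)) \<le> ?C" for x t
      using norm_le_sup_norm[OF bounded_range_schwartz_T[OF \<phi>]] by (simp only: power_0 mult_1_left)
    then have *: "norm (x ^ 0 *\<^sub>R (fderiv1 ^^ n) (\<lambda>x. (\<phi> (x + h) - \<phi> x - h *\<^sub>R fderiv1 \<phi> x) /\<^sub>R h) x) \<le> ?C * \<bar>h\<bar>" for h x
      by (intro norm_quotient_le[OF sm])
    have "\<forall>\<^sub>F h in at 0. \<forall>x.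
        norm ((fderiv1 ^^ n) (\<lambda>x. (\<phi> (x + h) - \<phi> x - h *\<^sub>R fderiv1 \<phi> x) /\<^sub>R h) x) \<le> ?C * \<bar>h\<bar>"
      using * by (simp only: power_0 scaleR_one) simp
    then show "((\<lambda>h. p (\<lambda>x. (\<phi> (x + h) - \<phi> x - h *\<^sub>R fderiv1 \<phi> x) /\<^sub>R h)) \<longlongrightarrow> 0) (at 0)"
      unfolding p by (rule sup_norm_tendsto_zero) (rule tendsto_mult_abs_zero)
  qed
qed

section \<open>Periodization\<close>

lemma summable_on_comparison_real:
  fixes f g :: "'a \<Rightarrow> real"
  assumes "g summable_on A" "\<And>x. x \<in> A \<Longrightarrow> 0 \<le> f x" "\<And>x. x \<in> A \<Longrightarrow> f x \<le> g x"
  shows "f summable_on A"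
proof (rule nonneg_bdd_above_summable_on[OF assms(2)])
  have "sum f F \<le> infsum g A" if "F \<subseteq> A" "finite F" for F
  proof -
    have "sum f F \<le> sum g F" using that assms(3) by (intro sum_mono) blast
    also have "\<dots> \<le> infsum g A"
      using assms that by (intro finite_sum_le_infsum) (auto intro: order_trans)
    finally show ?thesis .
  qed
  then show "bdd_above (sum f ` {F. F \<subseteq> A \<and> finite F})" by (auto intro!: bdd_aboveI2)
qed

lemma summable_on_int_inverse_square: "(\<lambda>k::int. 1 / (1 + (of_int k)\<^sup>2) :: real) summable_on UNIV"
  (is "?b summable_on UNIV")
proof -
  have "summable (\<lambda>n. 1 / (1 + (of_nat n)\<^sup>2) :: real)"
  proof (rule summable_comparison_test)
    show "summable (\<lambda>n. inverse (of_nat n ^ 2) :: real)" by (rule inverse_power_summable) simp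
    have "norm (1 / (1 + (of_nat n)\<^sup>2) :: real) \<le> inverse (of_nat n ^ 2)" if "n \<ge> 1" for n
    proof -
      have "inverse (1 + (of_nat n)\<^sup>2 :: real) \<le> inverse (of_nat n ^ 2)"
        using that by (intro le_imp_inverse_le) auto
      then show ?thesis by (simp add: inverse_eq_divide)
    qed
    then show "\<exists>N. \<forall>n\<ge>N. norm (1 / (1 + (of_nat n)\<^sup>2) :: real) \<le> inverse (of_nat n ^ 2)" by blast
  qed
  then have nat: "(\<lambda>n. 1 / (1 + (of_nat n)\<^sup>2) :: real) summable_on UNIV"
    by (rule summable_nonneg_imp_summable_on) simp
  have "?b summable_on range int"
    using nat by (subst summable_on_reindex) (auto simp: o_def)
  \<comment> \<open>The second half starts at 1 so that 0 belongs to only one of the two disjoint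
    halves.\<close>
  moreover have "?b summable_on ((\<lambda>n. - int n) ` {1..})"
    using summable_on_subset_banach[OF nat, of "{1..}"]
    by (subst summable_on_reindex) (auto simp: o_def inj_on_def)
  moreover have "range int \<inter> (\<lambda>n. - int n) ` {1..} = {}" by auto
  ultimately have "?b summable_on (range int \<union> (\<lambda>n. - int n) ` {1..})"
    by (rule summable_on_Un_disjoint)
  moreover have "k \<in> range int \<union> (\<lambda>n. - int n) ` {1..}" for k
  proof (cases k)
    case (neg n)
    then have "k = - int (Suc n)" by simp
    then show ?thesis by fastforce
  qed simp
  then have "range int \<union> (\<lambda>n. - int n) ` {1..} = UNIV" by blast
  ultimately show ?thesis by simp
qed

text \<open>The 3 is the factor in \<open>one_plus_square_le\<close>; the series is the one that
  dominates the integer translates of a function with quadratic decay.\<close>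

definition periodize_const :: real where
  "periodize_const = 3 * (\<Sum>\<^sub>\<infinity>k::int. 1 / (1 + (of_int k)\<^sup>2))"

lemma periodize_const_nonneg: "0 \<le> periodize_const"
  unfolding periodize_const_def by (intro mult_nonneg_nonneg infsum_nonneg) auto

text \<open>The trivial powers \<open>x ^ 0\<close> and \<open>fderiv1 ^^ 0\<close> make both
  summands literal members of \<open>seminorms_R\<close>, so that domination is immediate. Weight 2
  gives decay summable over the integers, and weight 0 covers the points near the origin.\<close>

definition decay_norm :: "('k::real_normed_field) fn \<Rightarrow> real" where
  "decay_norm \<phi> = sup_norm (\<lambda>x. x ^ 0 *\<^sub>R (fderiv1 ^^ 0) \<phi> x) + sup_norm (\<lambda>x. x ^ 2 *\<^sub>R (fderiv1 ^^ 0) \<phi> x)"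

lemma norm_schwartz_R_decay:
  assumes "\<phi> \<in> schwartz_R" shows "norm (\<phi> y) \<le> decay_norm \<phi> / (1 + y\<^sup>2)"
proof -
  have "norm (\<phi> y) \<le> sup_norm (\<lambda>x. x ^ 0 *\<^sub>R (fderiv1 ^^ 0) \<phi> x)"
    using norm_le_sup_norm[OF bounded_range_schwartz_R[OF assms, of 0 0], of y] by simp
  moreover have "y\<^sup>2 * norm (\<phi> y) \<le> sup_norm (\<lambda>x. x ^ 2 *\<^sub>R (fderiv1 ^^ 0) \<phi> x)"
    using norm_le_sup_norm[OF bounded_range_schwartz_R[OF assms, of 2 0], of y] by simp
  ultimately have "norm (\<phi> y) * (1 + y\<^sup>2) \<le> decay_norm \<phi>"
    unfolding decay_norm_def by (simp add: algebra_simps)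
  moreover have "0 < 1 + y\<^sup>2" by (simp add: add_pos_nonneg)
  ultimately show ?thesis by (simp add: pos_le_divide_eq)
qed

lemma decay_norm_nonneg: "\<phi> \<in> schwartz_R \<Longrightarrow> 0 \<le> decay_norm \<phi>"
  unfolding decay_norm_def by (intro add_nonneg_nonneg sup_norm_nonneg bounded_range_schwartz_R)

text \<open>Expanding (a - 2 t)^2 \<ge> 0 gives a^2 \<le> 2 (a - t)^2 + 2 t^2, and t^2 \<le> 1. It
  is used with \<open>t = frac x\<close> to compare the distance from \<open>x\<close> to the
  integer \<open>k\<close> with the integer \<open>k - \<lfloor>x\<rfloor>\<close>.\<close>

lemma one_plus_square_le:
  fixes a t :: real assumes "\<bar>t\<bar> \<le> 1" shows "1 + a\<^sup>2 \<le> 3 * (1 + (a - t)\<^sup>2)"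
proof -
  have "t\<^sup>2 \<le> 1" using assms by (simp add: abs_square_le_1)
  moreover have "0 \<le> (a - 2 * t)\<^sup>2" by simp
  then have "a\<^sup>2 \<le> 2 * (a - t)\<^sup>2 + 2 * t\<^sup>2" by (simp add: power2_eq_square algebra_simps)
  moreover have "0 \<le> (a - t)\<^sup>2" by simp
  moreover have "1 + A \<le> 3 * (1 + X)" if "T \<le> 1" "A \<le> 2 * X + 2 * T" "0 \<le> X" for A X T :: real
    using that by simp
  ultimately show ?thesis by blast
qed

text \<open>The bound must be uniform in \<open>x\<close>. Reindexing by the integer part of
  \<open>x\<close> leaves only the fractional part, which costs a constant factor, and the
  dominating series no longer depends on \<open>x\<close>.\<close>

lemma schwartz_R_periodization_bound:
  assumes \<phi>: "\<phi> \<in> schwartz_R"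
  shows "(\<lambda>k::int. norm (\<phi> (x - of_int k))) summable_on UNIV"
    and "(\<Sum>\<^sub>\<infinity>k::int. norm (\<phi> (x - of_int k))) \<le> periodize_const * decay_norm \<phi>"
proof -
  let ?b = "\<lambda>k::int. 1 / (1 + (of_int k)\<^sup>2) :: real"
  let ?A = "3 * decay_norm \<phi>"
  have bij: "bij_betw (\<lambda>k. k - \<lfloor>x\<rfloor>) UNIV UNIV"
    by (rule bij_betw_byWitness[of _ "\<lambda>k. k + \<lfloor>x\<rfloor>"]) auto
  have sb: "(\<lambda>k. ?b (k - \<lfloor>x\<rfloor>)) summable_on UNIV"
    using summable_on_reindex_bij_betw[OF bij, of ?b] summable_on_int_inverse_square by blast
  have ib: "(\<Sum>\<^sub>\<infinity>k. ?b (k - \<lfloor>x\<rfloor>)) = infsum ?b UNIV"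
    using infsum_reindex_bij_betw[OF bij, of ?b] .
  have le: "norm (\<phi> (x - of_int k)) \<le> ?A * ?b (k - \<lfloor>x\<rfloor>)" for k
  proof -
    have "\<bar>frac x\<bar> \<le> 1" using frac_ge_0[of x] frac_lt_1[of x] by linarith
    from one_plus_square_le[OF this, of "of_int (k - \<lfloor>x\<rfloor>)"]
    have *: "1 + (of_int (k - \<lfloor>x\<rfloor>))\<^sup>2 \<le> 3 * (1 + (x - of_int k)\<^sup>2)"
      by (simp add: frac_def power2_commute)
    have pos: "0 < 1 + (of_int (k - \<lfloor>x\<rfloor>) :: real)\<^sup>2" "0 < 1 + (x - of_int k)\<^sup>2"
      by (simp_all only: add_pos_nonneg zero_less_one zero_le_power2)
    have "norm (\<phi> (x - of_int k)) \<le> decay_norm \<phi> / (1 + (x - of_int k)\<^sup>2)"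
      by (rule norm_schwartz_R_decay[OF \<phi>])
    also have "\<dots> = ?A / (3 * (1 + (x - of_int k)\<^sup>2))"
      by (rule mult_divide_mult_cancel_left[symmetric]) simp
    also have "\<dots> \<le> ?A / (1 + (of_int (k - \<lfloor>x\<rfloor>))\<^sup>2)"
      using * pos decay_norm_nonneg[OF \<phi>] by (intro divide_left_mono mult_pos_pos) auto
    finally show ?thesis by simp
  qed
  have sA: "(\<lambda>k. ?A * ?b (k - \<lfloor>x\<rfloor>)) summable_on UNIV"
    using sb by (rule summable_on_cmult_right)
  show s: "(\<lambda>k::int. norm (\<phi> (x - of_int k))) summable_on UNIV"
    by (rule summable_on_comparison_real[OF sA norm_ge_zero le])
  have "(\<Sum>\<^sub>\<infinity>k::int. norm (\<phi> (x - of_int k))) \<le> (\<Sum>\<^sub>\<infinity>k. ?A * ?b (k - \<lfloor>x\<rfloor>))"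
    by (rule infsum_mono[OF s sA le])
  also have "\<dots> = ?A * infsum ?b UNIV"
    unfolding infsum_cmult_right[OF sb] ib ..
  finally show "(\<Sum>\<^sub>\<infinity>k::int. norm (\<phi> (x - of_int k))) \<le> periodize_const * decay_norm \<phi>"
    by (simp add: periodize_const_def mult_ac)
qed

lemma summable_schwartz_R:
  fixes \<phi> :: "real \<Rightarrow> 'k::{real_normed_field,banach}"
  assumes "\<phi> \<in> schwartz_R"
  shows "(\<lambda>k::int. \<phi> (x - of_int k)) summable_on UNIV"
  using schwartz_R_periodization_bound(1)[OF assms] by (rule abs_summable_summable)

lemma norm_periodize_le:
  assumes "\<phi> \<in> schwartz_R"
  shows "norm (periodize \<phi> x) \<le> periodize_const * decay_norm \<phi>"
  unfolding periodize_def
  using norm_infsum_bound[OF schwartz_R_periodization_bound(1)[OF assms]]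
    schwartz_R_periodization_bound(2)[OF assms] order_trans by blast

lemma periodize_lincomb:
  fixes \<phi> \<psi> :: "real \<Rightarrow> 'k::{real_normed_field,banach}"
  assumes "\<phi> \<in> schwartz_R" "\<psi> \<in> schwartz_R"
  shows "periodize (\<lambda>x. a * \<phi> x + b * \<psi> x) = (\<lambda>x. a * periodize \<phi> x + b * periodize \<psi> x)"
  unfolding periodize_def
  by (intro ext, subst infsum_add)
    (simp_all add: summable_on_cmult_right infsum_cmult_right summable_schwartz_R assms)

lemma periodize_shift: "periodize (\<lambda>x. \<phi> (x + h)) = (\<lambda>x. periodize \<phi> (x + h))"
  by (simp add: periodize_def algebra_simps)

lemma periodic1_periodize: "periodic1 (periodize \<phi>)"
  unfolding periodic1_def
proof
  fix x
  have bij: "bij_betw (\<lambda>k::int. k - 1) UNIV UNIV"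
    by (rule bij_betw_byWitness[of _ "\<lambda>k. k + 1"]) auto
  show "periodize \<phi> (x + 1) = periodize \<phi> x"
    using infsum_reindex_bij_betw[OF bij, of "\<lambda>k. \<phi> (x - of_int k)"]
    by (simp add: periodize_def algebra_simps)
qed

text \<open>Evaluating a periodization at 0 is a tempered distribution, so that the general derivative
  formula for shifts yields differentiation under the sum.\<close>
lemma periodize_has_vector_derivative:
  fixes \<phi> :: "real \<Rightarrow> 'k::{real_normed_field,banach}"
  assumes \<phi>: "\<phi> \<in> schwartz_R"
  shows "(periodize \<phi> has_vector_derivative periodize (fderiv1 \<phi>) x) (at x)"
proof -
  define u :: "'k functional" where "u \<psi> = (if \<psi> \<in> schwartz_R then periodize \<psi> 0 else 0)" for \<psi>
  have "dominated schwartz_R seminorms_R (decay_norm :: 'k fn \<Rightarrow> real)"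
    unfolding decay_norm_def by (intro R.dominated_add R.dominated_mem seminorms_R_I)
  then have "dominated schwartz_R seminorms_R (\<lambda>\<psi>::'k fn. periodize_const * decay_norm \<psi>)"
    using periodize_const_nonneg by (rule R.dominated_mult)
  then have "dominated schwartz_R seminorms_R (\<lambda>\<psi>. norm (u \<psi>))"
    by (rule R.dominated_le) (simp add: u_def norm_periodize_le)
  then have u: "u \<in> top_dual schwartz_R seminorms_R"
    unfolding R.top_dual_iff by (simp add: u_def schwartz_R_lincomb periodize_lincomb)
  have "u (\<lambda>y. \<psi> (y + h)) = periodize \<psi> h" if "\<psi> \<in> schwartz_R" for \<psi> h
    using R.shift_mem[OF that] by (simp add: u_def periodize_shift)
  then show ?thesis
    using R.has_vector_derivative_shift[OF u \<phi>, of x] R.fderiv1_mem[OF \<phi>] \<phi> by simp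
qed

lemma funpow_fderiv1_schwartz_R: "\<phi> \<in> schwartz_R \<Longrightarrow> (fderiv1 ^^ n) \<phi> \<in> schwartz_R"
  by (induction n) (simp_all add: R.fderiv1_mem)

lemma smooth_periodize:
  fixes \<phi> :: "real \<Rightarrow> 'k::{real_normed_field,banach}"
  assumes \<phi>: "\<phi> \<in> schwartz_R"
  shows "smooth (periodize \<phi>)" "(fderiv1 ^^ n) (periodize \<phi>) = periodize ((fderiv1 ^^ n) \<phi>)"
proof -
  let ?D = "\<lambda>n. periodize ((fderiv1 ^^ n) \<phi>)"
  have "(?D n has_vector_derivative ?D (Suc n) x) (at x)" for n x
    using periodize_has_vector_derivative[OF funpow_fderiv1_schwartz_R[OF \<phi>, of n]] by simp
  from smooth_derivatives[of ?D "periodize \<phi>", OF _ this]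
  show "smooth (periodize \<phi>)" "(fderiv1 ^^ n) (periodize \<phi>) = ?D n" by simp_all
qed

lemma periodize_mem:
  fixes \<phi> :: "real \<Rightarrow> 'k::{real_normed_field,banach}"
  shows "\<phi> \<in> schwartz_R \<Longrightarrow> periodize \<phi> \<in> schwartz_T"
  by (simp add: schwartz_T_def smooth_periodize periodic1_periodize)

text \<open>The embedding is the transpose of periodization. Derivatives commute with periodization,
  so the n-th seminorm on the circle is controlled by the decay of the n-th derivative on the
  line.\<close>

lemma embed_T_mem:
  fixes f :: "('k::{real_normed_field,banach}) functional"
  assumes "f \<in> distributions_T" shows "embed_T f \<in> tempered_R"
  unfolding tempered_R_eq embed_T_def
proof (rule R.top_dual_comp[OF T.seminormed_space_axioms assms[unfolded distributions_T_eq]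
    periodize_mem periodize_lincomb])
  fix q :: "'k fn \<Rightarrow> real" assume "q \<in> seminorms_T"
  then obtain n where q: "q = (\<lambda>\<phi>. sup_norm ((fderiv1 ^^ n) \<phi>))" by (auto simp: seminorms_T_def)
  \<comment> \<open>This is \<open>decay_norm\<close> of the n-th derivative, spelled out through
    members of \<open>seminorms_R\<close>.\<close>
  let ?A = "\<lambda>\<phi>::'k fn. sup_norm (\<lambda>x. x ^ 0 *\<^sub>R (fderiv1 ^^ n) \<phi> x) + sup_norm (\<lambda>x. x ^ 2 *\<^sub>R (fderiv1 ^^ n) \<phi> x)"
  have "dominated schwartz_R seminorms_R (\<lambda>\<phi>. periodize_const * ?A \<phi>)"
    by (intro R.dominated_mult R.dominated_add R.dominated_mem seminorms_R_I periodize_const_nonneg)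
  then show "dominated schwartz_R seminorms_R (\<lambda>\<phi>. q (periodize \<phi>))"
  proof (rule R.dominated_le)
    fix \<phi> :: "'k fn" assume \<phi>: "\<phi> \<in> schwartz_R"
    show "q (periodize \<phi>) \<le> periodize_const * ?A \<phi>"
      unfolding q smooth_periodize(2)[OF \<phi>]
      using norm_periodize_le[OF funpow_fderiv1_schwartz_R[OF \<phi>, of n]]
      by (intro sup_norm_le) (simp add: decay_norm_def)
  qed
qed

lemma embed_T_translate: "embed_T (translate h f) = translate h (embed_T f)"
proof
  fix \<phi> :: "'a fn"
  have "(\<lambda>x. \<phi> (x + h)) \<in> schwartz_R \<longleftrightarrow> \<phi> \<in> schwartz_R"
    using R.shift_mem[of \<phi> h] R.shift_mem[of "\<lambda>x. \<phi> (x + h)" "- h"] by auto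
  then show "embed_T (translate h f) \<phi> = translate h (embed_T f) \<phi>"
    by (simp add: embed_T_def translate_def periodize_shift)
qed

lemma translate_one_distribution_T:
  assumes "f \<in> distributions_T" shows "translate 1 f = f"
proof -
  have "(\<lambda>x. \<phi> (x + 1)) = \<phi>" if "\<phi> \<in> schwartz_T" for \<phi> :: "'a fn"
    using that by (simp add: schwartz_T_def periodic1_def)
  then show ?thesis
    using assms T.translate_eq_iff unfolding distributions_T_eq by fastforce
qed

section \<open>Periodic finite measures on the line\<close>

lemma bounded_range_C0_R:
  assumes "\<phi> \<in> C0_R" shows "bounded (range \<phi>)"
proof -
  have "\<forall>\<^sub>F x in at_infinity. norm (\<phi> x) < 1"
    using assms tendsto_norm_zero[of \<phi> at_infinity] order_tendstoD(2)[of "\<lambda>x. norm (\<phi> x)" 0 at_infinity 1]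
    by (simp add: C0_R_def)
  then obtain b where b: "\<And>x. norm x \<ge> b \<Longrightarrow> norm (\<phi> x) < 1"
    by (auto simp: eventually_at_infinity)
  have "continuous_on (cball 0 b) \<phi>"
    using assms continuous_on_subset[of UNIV \<phi> "cball 0 b"] by (simp add: C0_R_def)
  then have "bounded (\<phi> ` cball 0 b)"
    by (rule compact_imp_bounded[OF compact_continuous_image[OF _ compact_cball]])
  then obtain B where "\<forall>y\<in>\<phi> ` cball 0 b. norm y \<le> B" unfolding bounded_iff by blast
  then have B: "norm (\<phi> x) \<le> B" if "norm x \<le> b" for x using that by simp
  have "norm (\<phi> x) \<le> max B 1" for x
    using b[of x] B[of x] by (cases "norm x \<le> b") (auto simp: max_def)
  then show ?thesis by (auto simp: bounded_iff)
qed

lemma bounded_range_C_T: "\<phi> \<in> C_T \<Longrightarrow> bounded (range \<phi>)"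
  by (simp add: C_T_def bounded_range_periodic1)

lemma schwartz_R_subset_C0_R: "schwartz_R \<subseteq> C0_R"
proof
  fix \<phi> :: "'a fn" assume \<phi>: "\<phi> \<in> schwartz_R"
  have "((\<lambda>x::real. decay_norm \<phi> / (1 + x\<^sup>2)) \<longlongrightarrow> 0) at_infinity"
  proof (rule Lim_null_comparison)
    let ?g = "\<lambda>x::real. decay_norm \<phi> * (1 / norm x)"
    have "norm (decay_norm \<phi> / (1 + x\<^sup>2)) \<le> ?g x" if "1 \<le> norm x" for x
    proof -
      have "\<bar>x\<bar> \<le> x\<^sup>2" using that self_le_power[of "\<bar>x\<bar>" 2] by simp
      then have "decay_norm \<phi> / (1 + x\<^sup>2) \<le> decay_norm \<phi> / \<bar>x\<bar>"
        using that decay_norm_nonneg[OF \<phi>] by (intro divide_left_mono mult_pos_pos) (auto intro: add_pos_nonneg)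
      then show ?thesis using decay_norm_nonneg[OF \<phi>] by (simp add: abs_of_nonneg add_nonneg_nonneg)
    qed
    then show "\<forall>\<^sub>F x in at_infinity. norm (decay_norm \<phi> / (1 + x\<^sup>2)) \<le> ?g x"
      unfolding eventually_at_infinity by blast
    have "((\<lambda>x::real. 1 / norm x) \<longlongrightarrow> 0) at_infinity"
      using tendsto_norm_zero[OF tendsto_inverse_0[where 'a = real]] by (simp add: norm_divide inverse_eq_divide)
    from tendsto_mult_right_zero[OF this, of "decay_norm \<phi>"] show "(?g \<longlongrightarrow> 0) at_infinity" .
  qed
  then have "(\<phi> \<longlongrightarrow> 0) at_infinity"
    by (rule Lim_null_comparison[rotated]) (simp add: norm_schwartz_R_decay[OF \<phi>])
  moreover have "continuous_on UNIV \<phi>" using R.mem_smooth[OF \<phi>] by (rule smooth_continuous_on)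
  ultimately show "\<phi> \<in> C0_R" by (simp add: C0_R_def)
qed

interpretation C0: seminormed_space C0_R "{sup_norm}"
proof -
  \<comment> \<open>The index type \<open>unit\<close> presents the single norm as a family, the
    form in which the general construction expects it.\<close>
  have "seminormed_space C0_R ((\<lambda>i::unit. \<lambda>\<phi>::'a fn. sup_norm ((\<lambda>i \<phi>. \<phi>) i \<phi>)) ` UNIV)"
  proof (rule seminormed_space_sup_norm)
    fix \<phi> \<psi> :: "'a fn" and a b assume "\<phi> \<in> C0_R" "\<psi> \<in> C0_R"
    then have "((\<lambda>x. a * \<phi> x + b * \<psi> x) \<longlongrightarrow> a * 0 + b * 0) at_infinity"
      unfolding C0_R_def by (intro tendsto_intros) auto
    then show "(\<lambda>x. a * \<phi> x + b * \<psi> x) \<in> C0_R"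
      using \<open>\<phi> \<in> C0_R\<close> \<open>\<psi> \<in> C0_R\<close> by (auto simp: C0_R_def intro!: continuous_intros)
  qed (auto simp: bounded_range_C0_R, simp add: C0_R_def)
  then show "seminormed_space C0_R {sup_norm :: 'a fn \<Rightarrow> real}" by simp
qed

interpretation CT: seminormed_space C_T "{sup_norm}"
proof -
  have "seminormed_space C_T ((\<lambda>i::unit. \<lambda>\<phi>::'a fn. sup_norm ((\<lambda>i \<phi>. \<phi>) i \<phi>)) ` UNIV)"
  proof (rule seminormed_space_sup_norm)
    fix \<phi> \<psi> :: "'a fn" and a b assume "\<phi> \<in> C_T" "\<psi> \<in> C_T"
    then show "(\<lambda>x. a * \<phi> x + b * \<psi> x) \<in> C_T"
      by (auto simp: C_T_def periodic1_lincomb intro!: continuous_intros)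
  qed (auto simp: bounded_range_C_T, simp add: C_T_def periodic1_def)
  then show "seminormed_space C_T {sup_norm :: 'a fn \<Rightarrow> real}" by simp
qed

lemma schwartz_T_subset_C_T: "schwartz_T \<subseteq> C_T"
  using smooth_continuous_on by (auto simp: schwartz_T_def C_T_def)

lemma sum_shifts_schwartz_R:
  assumes \<phi>: "\<phi> \<in> schwartz_R"
  shows "(\<lambda>x. \<Sum>k<n. \<phi> (x + of_nat k)) \<in> schwartz_R"
proof (induction n)
  case 0
  then show ?case using R.zero_mem by simp
next
  case (Suc n)
  from R.lincomb_mem[OF Suc R.shift_mem[OF \<phi>, of "of_nat n"], of 1 1] show ?case by simp
qed

text \<open>The \<open>n\<close> shifts are the terms with index 0, -1, ..., 1 - n of the
  periodization series of norms; hence a bound independent of both \<open>n\<close> and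
  \<open>x\<close>.\<close>

lemma norm_sum_shifts_schwartz_R_le:
  assumes \<phi>: "\<phi> \<in> schwartz_R"
  shows "norm (\<Sum>k<n. \<phi> (x + of_nat k)) \<le> periodize_const * decay_norm \<phi>"
proof -
  have "norm (\<Sum>k<n. \<phi> (x + of_nat k)) \<le> (\<Sum>k<n. norm (\<phi> (x + of_nat k)))" by (rule norm_sum)
  also have "\<dots> = (\<Sum>k\<in>(\<lambda>k. - int k) ` {..<n}. norm (\<phi> (x - of_int k)))"
    by (subst sum.reindex) (auto simp: inj_on_def)
  also have "\<dots> \<le> (\<Sum>\<^sub>\<infinity>k::int. norm (\<phi> (x - of_int k)))"
    using schwartz_R_periodization_bound(1)[OF \<phi>] by (rule finite_sum_le_infsum) auto
  also have "\<dots> \<le> periodize_const * decay_norm \<phi>" by (rule schwartz_R_periodization_bound(2)[OF \<phi>])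
  finally show ?thesis .
qed

text \<open>The averages of the first \<open>n\<close> integer shifts of a Schwartz function tend to 0 uniformly.\<close>
lemma periodic_measure_R_zero:
  assumes \<mu>: "\<mu> \<in> measures_R" and per: "\<And>\<psi>. \<psi> \<in> schwartz_R \<Longrightarrow> \<mu> (\<lambda>x. \<psi> (x + 1)) = \<mu> \<psi>"
    and \<phi>: "\<phi> \<in> schwartz_R"
  shows "\<mu> \<phi> = 0"
proof -
  have \<mu>': "\<mu> \<in> top_dual C0_R {sup_norm}" using \<mu> by (simp add: measures_R_def)
  have C0: "\<psi> \<in> C0_R" if "\<psi> \<in> schwartz_R" for \<psi> :: "'a fn" using that schwartz_R_subset_C0_R by blast
  have shift: "\<mu> (\<lambda>x. \<phi> (x + of_nat k)) = \<mu> \<phi>" for k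
  proof (induction k)
    case (Suc k)
    then show ?case
      using per[OF R.shift_mem[OF \<phi>, of "of_nat k"]] by (simp add: add_ac)
  qed simp
  define s where "s n = (\<lambda>x. \<Sum>k<n. \<phi> (x + of_nat k))" for n
  have s: "s n \<in> schwartz_R" for n unfolding s_def by (rule sum_shifts_schwartz_R[OF \<phi>])
  have \<mu>s: "\<mu> (s n) = of_nat n * \<mu> \<phi>" for n
  proof (induction n)
    case 0
    then show ?case using top_dual_linear[OF \<mu>' C0.zero_mem C0.zero_mem, of 0 0] by (simp add: s_def)
  next
    case (Suc n)
    have "\<mu> (s (Suc n)) = \<mu> (\<lambda>x. 1 * s n x + 1 * \<phi> (x + of_nat n))" by (simp add: s_def)
    also have "\<dots> = 1 * \<mu> (s n) + 1 * \<mu> (\<lambda>x. \<phi> (x + of_nat n))"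
      by (rule top_dual_linear[OF \<mu>' C0[OF s] C0[OF R.shift_mem[OF \<phi>]]])
    finally show ?case using Suc shift by (simp add: algebra_simps)
  qed
  \<comment> \<open>Every average has the same value under \<mu> as \<phi>, while its sup norm is
    O(1/n). Using \<open>Suc n\<close> avoids inverting 0.\<close>
  define avg where "avg n = (\<lambda>x. inverse (of_nat (Suc n)) * s (Suc n) x)" for n
  have avg: "avg n \<in> C0_R" for n
    unfolding avg_def by (intro C0.scale_mem C0 s)
  have "\<mu> (avg n) = \<mu> \<phi>" for n
  proof -
    have "\<mu> (avg n) = inverse (of_nat (Suc n)) * \<mu> (s (Suc n))"
      using top_dual_linear[OF \<mu>' C0[OF s] C0[OF s], of "inverse (of_nat (Suc n))" "Suc n" 0 "Suc n"]
      by (simp add: avg_def)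
    then show ?thesis unfolding \<mu>s by (simp del: of_nat_Suc)
  qed
  moreover have "(\<lambda>n. \<mu> (avg n)) \<longlonglongrightarrow> 0"
  proof (rule C0.top_dual_tendsto[OF \<mu>'])
    show "\<forall>\<^sub>F n in sequentially. avg n \<in> C0_R" using avg by simp
    fix p :: "'a fn \<Rightarrow> real" assume p: "p \<in> {sup_norm}"
    let ?K = "periodize_const * decay_norm \<phi>"
    have "norm (avg n x) \<le> inverse (of_nat (Suc n)) * ?K" for n x
      using norm_sum_shifts_schwartz_R_le[OF \<phi>, where n="Suc n" and x=x]
      unfolding avg_def s_def norm_mult norm_inverse norm_of_nat by (intro mult_left_mono) auto
    then have "(\<lambda>n. sup_norm (avg n)) \<longlonglongrightarrow> 0"
      using tendsto_mult_left_zero[OF LIMSEQ_inverse_real_of_nat, of ?K]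
      by (intro sup_norm_tendsto_zero[where g="\<lambda>n. inverse (of_nat (Suc n)) * ?K"]) auto
    then show "(\<lambda>n. p (avg n)) \<longlonglongrightarrow> 0" using p by simp
  qed
  ultimately show ?thesis by (simp add: LIMSEQ_const_iff)
qed

section \<open>Means of periodic functions\<close>

definition mean_T :: "('k::{real_normed_field,euclidean_space}) fn \<Rightarrow> 'k" where
  "mean_T \<phi> = integral {0..1} \<phi>"

lemma continuous_on_C_T: "\<phi> \<in> C_T \<Longrightarrow> continuous_on S \<phi>"
  unfolding C_T_def using continuous_on_subset by blast

lemma mean_T_lincomb:
  fixes \<phi> \<psi> :: "('k::{real_normed_field,euclidean_space}) fn"
  assumes "\<phi> \<in> C_T" "\<psi> \<in> C_T"
  shows "mean_T (\<lambda>x. a * \<phi> x + b * \<psi> x) = a * mean_T \<phi> + b * mean_T \<psi>"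
proof -
  have "\<phi> integrable_on {0..1}" "\<psi> integrable_on {0..1}"
    using assms by (simp_all add: integrable_continuous_real continuous_on_C_T)
  then have "((\<lambda>x. a * \<phi> x + b * \<psi> x) has_integral a * mean_T \<phi> + b * mean_T \<psi>) {0..1}"
    unfolding mean_T_def
    by (intro has_integral_add has_integral_mult_right integrable_integral)
  then show ?thesis unfolding mean_T_def by (rule integral_unique)
qed

lemma norm_mean_T_le:
  fixes \<phi> :: "('k::{real_normed_field,euclidean_space}) fn"
  assumes "\<phi> \<in> C_T" shows "norm (mean_T \<phi>) \<le> sup_norm \<phi>"
  using integral_bound[of 0 1 \<phi> "sup_norm \<phi>"] norm_le_sup_norm[OF bounded_range_C_T[OF assms]]
    continuous_on_C_T[OF assms] by (simp add: mean_T_def)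

text \<open>For an antiderivative F on the whole line, F(x + 1) - F(x) has derivative \<phi>(x + 1)
  - \<phi>(x) = 0. Its constant value is the integral over [0, 1], and at x = h it is the mean of
  the function shifted by \<open>h\<close>, so one F settles both claims.\<close>

lemma periodic_antiderivative:
  fixes \<phi> :: "('k::{real_normed_field,euclidean_space}) fn"
  assumes "\<phi> \<in> C_T"
  shows "\<exists>F. (\<forall>x. (F has_vector_derivative \<phi> x) (at x)) \<and> (\<forall>x. F (x + 1) = F x + mean_T \<phi>)"
    and "mean_T (\<lambda>x. \<phi> (x + h)) = mean_T \<phi>"
proof -
  have "isCont \<phi> x" for x
    using continuous_on_C_T[OF assms, of UNIV] by (simp add: continuous_on_eq_continuous_at)
  then obtain F where F: "\<And>x. (F has_vector_derivative \<phi> x) (at x)"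
    using einterval_antiderivative[of "-\<infinity>" "\<infinity>" \<phi>] by auto
  have shift: "((\<lambda>x. F (x + h)) has_vector_derivative \<phi> (x + h)) (at x)" for x h
  proof -
    have "((\<lambda>x. x + h) has_vector_derivative 1) (at x)"
      by (auto intro!: derivative_eq_intros)
    from vector_diff_chain_at[OF this F] show ?thesis by (simp add: o_def)
  qed
  have mean: "mean_T (\<lambda>x. \<phi> (x + h)) = F (1 + h) - F h" for h
  proof -
    have "((\<lambda>x. \<phi> (x + h)) has_integral (F (1 + h) - F (0 + h))) {0..1}"
      by (rule fundamental_theorem_of_calculus[OF zero_le_one])
        (rule has_vector_derivative_at_within[OF shift])
    then show ?thesis unfolding mean_T_def by (simp add: integral_unique)
  qed
  let ?g = "\<lambda>x. F (x + 1) - F x"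
  have "(?g has_vector_derivative 0) (at x)" for x
    using has_vector_derivative_diff[OF shift[of 1 x] F[of x]] assms
    by (simp add: C_T_def periodic1_def)
  then have "(?g has_derivative (\<lambda>t. 0)) (at x within UNIV)" for x
    by (simp add: has_vector_derivative_def)
  then have const: "?g x = ?g 0" for x
    using has_derivative_zero_unique[of UNIV ?g x 0] by simp
  have "F 1 - F 0 = mean_T \<phi>" using mean[of 0] by simp
  then have *: "F (x + 1) - F x = mean_T \<phi>" for x using const[of x] by simp
  then show "\<exists>F. (\<forall>x. (F has_vector_derivative \<phi> x) (at x)) \<and> (\<forall>x. F (x + 1) = F x + mean_T \<phi>)"
    using F by (intro exI[of _ F]) (simp add: diff_eq_eq add.commute)
  show "mean_T (\<lambda>x. \<phi> (x + h)) = mean_T \<phi>"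
    using mean[of h] *[of h] by (simp add: add.commute)
qed

lemmas mean_T_shift = periodic_antiderivative(2)

lemma const_mem_schwartz_T: "(\<lambda>x. c) \<in> schwartz_T"
  by (simp add: schwartz_T_def smooth_const(1) periodic1_def)

lemma mean_T_const: "mean_T (\<lambda>x. c) = c"
  by (simp add: mean_T_def)

text \<open>The function \<open>\<phi> - mean_T \<phi>\<close> is the derivative of a periodic function.\<close>
lemma shift_invariant_eq_mean_T:
  fixes u :: "('k::{real_normed_field,euclidean_space}) functional"
  assumes u: "u \<in> distributions_T" and \<phi>: "\<phi> \<in> schwartz_T"
    and inv: "\<And>h. u (\<lambda>x. \<phi> (x + h)) = u \<phi>"
  shows "u \<phi> = mean_T \<phi> * u (\<lambda>x. 1)"
proof -
  note u' = u[unfolded distributions_T_eq]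
  let ?m = "mean_T \<phi>"
  have "\<phi> \<in> C_T" using \<phi> schwartz_T_subset_C_T by blast
  from periodic_antiderivative(1)[OF this]
  obtain F where "(\<forall>x. (F has_vector_derivative \<phi> x) (at x)) \<and> (\<forall>x. F (x + 1) = F x + ?m)" ..
  then have F: "\<And>x. (F has_vector_derivative \<phi> x) (at x)" "\<And>x. F (x + 1) = F x + ?m"
    by simp_all
  define \<psi> where "\<psi> = (\<lambda>x. 1 * \<phi> x + (- ?m) * 1)"
  \<comment> \<open>\<open>F\<close> grows by \<open>?m\<close> over each period; subtracting a
    linear function with that slope makes it periodic.\<close>
  define Q where "Q = (\<lambda>x. F x - of_real x * ?m)"
  have \<psi>: "\<psi> \<in> schwartz_T"
    unfolding \<psi>_def by (rule T.lincomb_mem[OF \<phi> const_mem_schwartz_T])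
  have Q: "(Q has_vector_derivative \<psi> x) (at x)" for x
  proof -
    have "((\<lambda>x. F x - x *\<^sub>R ?m) has_vector_derivative \<phi> x - 1 *\<^sub>R ?m) (at x)"
      by (intro has_vector_derivative_diff F(1)) (auto intro!: derivative_eq_intros)
    then show ?thesis by (simp add: Q_def \<psi>_def scaleR_conv_of_real)
  qed
  \<comment> \<open>\<open>Q\<close> is put in front of the derivatives of \<psi>, so that
    smoothness of \<open>Q\<close> is inherited from \<psi>.\<close>
  let ?D = "\<lambda>n. case n of 0 \<Rightarrow> Q | Suc k \<Rightarrow> (fderiv1 ^^ k) \<psi>"
  have D: "(?D n has_vector_derivative ?D (Suc n) x) (at x)" for n x
    using Q smooth_has_vector_derivative[OF T.mem_smooth[OF \<psi>]] by (cases n) simp_all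
  have "smooth Q" using smooth_derivatives(1)[of ?D Q, OF _ D] by simp
  moreover have "periodic1 Q" by (simp add: periodic1_def Q_def F(2) algebra_simps)
  ultimately have mem: "Q \<in> schwartz_T" by (simp add: schwartz_T_def)
  have dQ: "fderiv1 Q = \<psi>" using smooth_derivatives(2)[of ?D Q 1, OF _ D] by simp
  \<comment> \<open>Invariance at \<phi> makes the value of \<open>u\<close> on the shifts of Q'
    independent of \<open>h\<close>. Since \<open>Q\<close> is periodic, this constant slope must be
    0.\<close>
  have "u (\<lambda>x. fderiv1 Q (x + h)) = u \<phi> - ?m * u (\<lambda>x. 1)" for h
    using top_dual_linear[OF u' T.shift_mem[OF \<phi>] const_mem_schwartz_T, of 1 h "- ?m" 1]
    by (simp add: dQ \<psi>_def inv)
  moreover have "(\<lambda>x. Q (x + 1)) = Q" using \<open>periodic1 Q\<close> by (simp add: periodic1_def)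
  ultimately have "u \<phi> - ?m * u (\<lambda>x. 1) = 0"
    using T.periodic_deriv_constant_imp_zero[OF u' mem] by simp
  then show ?thesis by simp
qed

text \<open>The constant distribution 1 on the circle, that is, Lebesgue measure of total mass 1.
  Its value at the constant function 1 is 1, so subtracting a multiple of it can remove any
  mean.\<close>

definition one_T :: "('k::{real_normed_field,euclidean_space}) functional" where
  "one_T \<phi> = (if \<phi> \<in> schwartz_T then mean_T \<phi> else 0)"

lemma one_T_mem: "one_T \<in> distributions_T"
proof -
  have C: "\<phi> \<in> C_T" if "\<phi> \<in> schwartz_T" for \<phi> :: "'a fn"
    using that schwartz_T_subset_C_T by blast
  have "dominated schwartz_T seminorms_T (\<lambda>\<phi>::'a fn. sup_norm ((fderiv1 ^^ 0) \<phi>))"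
    by (rule T.dominated_mem[OF seminorms_T_I])
  then have "dominated schwartz_T seminorms_T (\<lambda>\<phi>::'a fn. norm (one_T \<phi>))"
    by (rule T.dominated_le) (simp add: one_T_def norm_mean_T_le C)
  then show ?thesis
    unfolding distributions_T_eq T.top_dual_iff
    by (simp add: one_T_def mean_T_lincomb T.lincomb_mem C)
qed

lemma translate_one_T: "translate h one_T = one_T"
  unfolding T.translate_eq_iff[OF one_T_mem[unfolded distributions_T_eq]]
proof
  fix \<phi> :: "'a fn" assume \<phi>: "\<phi> \<in> schwartz_T"
  then have "\<phi> \<in> C_T" using schwartz_T_subset_C_T by blast
  then show "one_T (\<lambda>x. \<phi> (x + h)) = one_T \<phi>"
    using \<phi> T.shift_mem[OF \<phi>, of h] by (simp add: one_T_def mean_T_shift)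
qed

text \<open>A multiple of Lebesgue measure on the circle; it represents the image of the constant
  distribution under a seasonal operator.\<close>

lemma mean_T_measure: "(\<lambda>\<phi>. if \<phi> \<in> C_T then mean_T \<phi> * c else 0) \<in> measures_T"
proof -
  have "dominated C_T {sup_norm} (\<lambda>\<phi>. norm c * sup_norm \<phi>)"
    by (intro CT.dominated_mult CT.dominated_mem) auto
  then have "dominated C_T {sup_norm} (\<lambda>\<phi>. norm (if \<phi> \<in> C_T then mean_T \<phi> * c else 0))"
    by (rule CT.dominated_le) (simp add: norm_mult mult.commute[of "norm c"] mult_right_mono norm_mean_T_le)
  then show ?thesis
    unfolding measures_T_def CT.top_dual_iff
    by (simp add: mean_T_lincomb CT.lincomb_mem algebra_simps)
qed

section \<open>The direct sum decomposition\<close>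

lemma is_measure_R_lincomb:
  assumes "is_measure_R f" "is_measure_R g"
  shows "is_measure_R (\<lambda>\<phi>. a * f \<phi> + b * g \<phi>)"
proof -
  obtain \<mu> \<nu> where "\<mu> \<in> measures_R" "\<nu> \<in> measures_R"
    "\<And>\<phi>. \<phi> \<in> schwartz_R \<Longrightarrow> f \<phi> = \<mu> \<phi>" "\<And>\<phi>. \<phi> \<in> schwartz_R \<Longrightarrow> g \<phi> = \<nu> \<phi>"
    using assms unfolding is_measure_R_def by blast
  then show ?thesis
    unfolding is_measure_R_def measures_R_def
    by (intro bexI[of _ "\<lambda>\<phi>. a * \<mu> \<phi> + b * \<nu> \<phi>"] C0.top_dual_lincomb) auto
qed

lemma is_measure_T_lincomb:
  assumes "is_measure_T f" "is_measure_T g"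
  shows "is_measure_T (\<lambda>\<phi>. a * f \<phi> + b * g \<phi>)"
proof -
  obtain \<mu> \<nu> where "\<mu> \<in> measures_T" "\<nu> \<in> measures_T"
    "\<And>\<phi>. \<phi> \<in> schwartz_T \<Longrightarrow> f \<phi> = \<mu> \<phi>" "\<And>\<phi>. \<phi> \<in> schwartz_T \<Longrightarrow> g \<phi> = \<nu> \<phi>"
    using assms unfolding is_measure_T_def by blast
  then show ?thesis
    unfolding is_measure_T_def measures_T_def
    by (intro bexI[of _ "\<lambda>\<phi>. a * \<mu> \<phi> + b * \<nu> \<phi>"] CT.top_dual_lincomb) auto
qed

lemma is_measure_R_zero: "is_measure_R (\<lambda>\<phi>. 0)"
  unfolding is_measure_R_def measures_R_def using top_dual_zero by fastforce

lemma is_measure_T_zero: "is_measure_T (\<lambda>\<phi>. 0)"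
  unfolding is_measure_T_def measures_T_def using top_dual_zero by fastforce

lemma subspaceI_lincomb:
  assumes "(\<lambda>\<phi>. 0) \<in> S"
    and "\<And>f g a b. f \<in> S \<Longrightarrow> g \<in> S \<Longrightarrow> (\<lambda>\<phi>. a * f \<phi> + b * g \<phi>) \<in> S"
  shows "functional_space.subspace (S :: ('k::field) functional set)"
  unfolding functional_space.subspace_def
proof (intro conjI ballI allI)
  show "0 \<in> S" using assms(1) by (simp add: zero_fun_def)
  show "f + g \<in> S" if "f \<in> S" "g \<in> S" for f g
    using assms(2)[OF that, of 1 1] by (simp add: plus_fun_def)
  show "(\<lambda>\<phi>. c * f \<phi>) \<in> S" if "f \<in> S" for c f
    using assms(2)[OF that that, of c 0] by simp
qed

lemma lsi_continuous_mem: "lsi_continuous W L \<Longrightarrow> f \<in> W \<Longrightarrow> L f \<in> W"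
  by (simp add: lsi_continuous_def)

lemma lsi_continuous_linear:
  "lsi_continuous W L \<Longrightarrow> f \<in> W \<Longrightarrow> g \<in> W \<Longrightarrow>
   L (\<lambda>\<phi>. a * f \<phi> + b * g \<phi>) = (\<lambda>\<phi>. a * L f \<phi> + b * L g \<phi>)"
  unfolding lsi_continuous_def by blast

lemma lsi_continuous_translate:
  "lsi_continuous W L \<Longrightarrow> f \<in> W \<Longrightarrow> L (translate h f) = translate h (L f)"
  unfolding lsi_continuous_def by blast

lemma lsi_continuous_zero: "lsi_continuous W L \<Longrightarrow> f \<in> W \<Longrightarrow> L (\<lambda>\<phi>. 0) = (\<lambda>\<phi>. 0)"
  using lsi_continuous_linear[of W L f f 0 0] by simp

lemma zero_mem_tempered_R: "(\<lambda>\<phi>. 0) \<in> tempered_R"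
  unfolding tempered_R_def by (rule top_dual_zero)

lemma zero_mem_distributions_T: "(\<lambda>\<phi>. 0) \<in> distributions_T"
  unfolding distributions_T_def by (rule top_dual_zero)

lemma M_R_lincomb:
  assumes L: "lsi_continuous tempered_R L" and "f \<in> M_R L" "g \<in> M_R L"
  shows "(\<lambda>\<phi>. a * f \<phi> + b * g \<phi>) \<in> M_R L"
proof -
  have fg: "f \<in> tempered_R" "g \<in> tempered_R" "is_measure_R (L f)" "is_measure_R (L g)"
    using assms(2,3) by (simp_all add: M_R_def)
  then show ?thesis
    using R.top_dual_lincomb[of f g a b] is_measure_R_lincomb
    by (simp add: M_R_def lsi_continuous_linear[OF L] tempered_R_eq)
qed

lemma M_T_lincomb:
  assumes L: "lsi_continuous distributions_T L" and "f \<in> M_T L" "g \<in> M_T L"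
  shows "(\<lambda>\<phi>. a * f \<phi> + b * g \<phi>) \<in> M_T L"
proof -
  have fg: "f \<in> distributions_T" "g \<in> distributions_T" "is_measure_T (L f)" "is_measure_T (L g)"
    using assms(2,3) by (simp_all add: M_T_def)
  then show ?thesis
    using T.top_dual_lincomb[of f g a b] is_measure_T_lincomb
    by (simp add: M_T_def lsi_continuous_linear[OF L] distributions_T_eq)
qed

lemma zero_mem_M_R: "lsi_continuous tempered_R L \<Longrightarrow> (\<lambda>\<phi>. 0) \<in> M_R L"
  by (simp add: M_R_def zero_mem_tempered_R is_measure_R_zero lsi_continuous_zero[OF _ zero_mem_tempered_R])

lemma zero_mem_M_T: "lsi_continuous distributions_T L \<Longrightarrow> (\<lambda>\<phi>. 0) \<in> M_T L"
  by (simp add: M_T_def zero_mem_distributions_T is_measure_T_zero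
      lsi_continuous_zero[OF _ zero_mem_distributions_T])

lemma embed_T_lincomb:
  "embed_T (\<lambda>\<phi>. a * f \<phi> + b * g \<phi>) = (\<lambda>\<phi>. a * embed_T f \<phi> + b * embed_T g \<phi>)"
  by (auto simp: embed_T_def)

lemma subspace_embed_T_image:
  fixes S :: "('k::real_normed_field) functional set"
  assumes "(\<lambda>\<phi>. 0) \<in> S"
    and "\<And>f g a b. f \<in> S \<Longrightarrow> g \<in> S \<Longrightarrow> (\<lambda>\<phi>. a * f \<phi> + b * g \<phi>) \<in> S"
  shows "functional_space.subspace (embed_T ` S)"
proof (rule subspaceI_lincomb)
  have "embed_T (\<lambda>\<phi>. 0 :: 'k) = (\<lambda>\<phi>. 0)" by (auto simp: embed_T_def)
  then show "(\<lambda>\<phi>. 0) \<in> embed_T ` S" using imageI[OF assms(1), of embed_T] by simp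
  fix u v :: "'k functional" and a b assume "u \<in> embed_T ` S" "v \<in> embed_T ` S"
  then obtain f g where fg: "f \<in> S" "g \<in> S" and "u = embed_T f" "v = embed_T g" by blast
  then have "(\<lambda>\<phi>. a * u \<phi> + b * v \<phi>) = embed_T (\<lambda>\<phi>. a * f \<phi> + b * g \<phi>)"
    by (simp only: embed_T_lincomb)
  then show "(\<lambda>\<phi>. a * u \<phi> + b * v \<phi>) \<in> embed_T ` S" using assms(2)[OF fg] by blast
qed

lemma is_direct_sumI:
  assumes U: "functional_space.subspace U" and V: "functional_space.subspace V"
    and W: "W = U + V" and zero: "\<And>f. f \<in> U \<Longrightarrow> f \<in> V \<Longrightarrow> f = 0"
  shows "is_direct_sum W U V"
  unfolding is_direct_sum_def
proof (intro conjI ballI U V W)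
  fix w assume "w \<in> W"
  then obtain u v where uv: "u \<in> U" "v \<in> V" "w = u + v" unfolding W by (rule set_plus_elim)
  show "\<exists>!p. p \<in> U \<times> V \<and> w = fst p + snd p"
  proof (rule ex1I[of _ "(u, v)"])
    show "(u, v) \<in> U \<times> V \<and> w = fst (u, v) + snd (u, v)" using uv by simp
    fix p assume p: "p \<in> U \<times> V \<and> w = fst p + snd p"
    have "u + v = fst p + snd p" using p uv(3) by simp
    then have "(u + v) \<phi> = (fst p + snd p) \<phi>" for \<phi> by simp
    then have eq: "u - fst p = snd p - v"
      by (intro ext) (simp add: algebra_simps)
    have "u - fst p \<in> U" using functional_space.subspace_diff[OF U uv(1)] p by auto
    moreover have "snd p - v \<in> V" using functional_space.subspace_diff[OF V _ uv(2)] p by auto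
    ultimately have "u - fst p = 0" using zero eq by metis
    then show "p = (u, v)" using eq by (auto simp: prod_eq_iff)
  qed
qed

section \<open>Periodic distributions under the trend and seasonal operators\<close>

lemma trend_admissibleE:
  assumes "trend_admissible N L"
  obtains A B where "lsi_continuous tempered_R L" "lsi_continuous tempered_R A" "lsi_continuous tempered_R B"
    "\<And>f. f \<in> tempered_R \<Longrightarrow> B (A f) = f"
    "\<And>f. f \<in> tempered_R \<Longrightarrow> L f = (distr_deriv schwartz_R ^^ N) (A f)"
  using assms unfolding trend_admissible_def admissible_def by blast

lemma periodic_M_R_imp_zero:
  assumes L: "lsi_continuous tempered_R L" and f: "f \<in> M_R L" and per: "translate 1 f = f"
  shows "L f = (\<lambda>\<phi>. 0)"
proof -
  have ft: "f \<in> tempered_R" "is_measure_R (L f)" using f by (simp_all add: M_R_def)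
  then have Lf: "L f \<in> top_dual schwartz_R seminorms_R"
    using lsi_continuous_mem[OF L] by (simp add: tempered_R_eq)
  have "translate 1 (L f) = L f" using lsi_continuous_translate[OF L ft(1), of 1] per by simp
  then have inv: "L f (\<lambda>x. \<psi> (x + 1)) = L f \<psi>" if "\<psi> \<in> schwartz_R" for \<psi>
    using R.translate_eq_iff[OF Lf] that by blast
  obtain \<mu> where \<mu>: "\<mu> \<in> measures_R" "\<And>\<phi>. \<phi> \<in> schwartz_R \<Longrightarrow> L f \<phi> = \<mu> \<phi>"
    using ft(2) unfolding is_measure_R_def by blast
  have "\<mu> (\<lambda>x. \<psi> (x + 1)) = \<mu> \<psi>" if "\<psi> \<in> schwartz_R" for \<psi>
    using inv[OF that] \<mu>(2)[OF that] \<mu>(2)[OF R.shift_mem[OF that]] by simp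
  from periodic_measure_R_zero[OF \<mu>(1) this] have "L f \<phi> = 0" if "\<phi> \<in> schwartz_R" for \<phi>
    using \<mu>(2) that by simp
  then show ?thesis using top_dual_outside[OF Lf] by blast
qed

text \<open>Both factors commute with shifts: \<open>A\<close> carries 1-periodicity of
  \<open>f\<close> to \<open>A f\<close>, where the powers of \<open>D\<close> can be removed, and
  the inverse \<open>B\<close> carries the resulting full shift invariance back to
  \<open>f\<close>.\<close>

lemma trend_kernel_on_periodic:
  assumes adm: "trend_admissible N L" and f: "f \<in> tempered_R" and per: "translate 1 f = f"
    and Lf: "L f = (\<lambda>\<phi>. 0)"
  shows "translate h f = f" and "N = 0 \<Longrightarrow> f = (\<lambda>\<phi>. 0)"
proof -
  obtain A B where AB: "lsi_continuous tempered_R A" "lsi_continuous tempered_R B"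
    "\<And>f. f \<in> tempered_R \<Longrightarrow> B (A f) = f"
    "\<And>f. f \<in> tempered_R \<Longrightarrow> L f = (distr_deriv schwartz_R ^^ N) (A f)"
    using adm by (rule trend_admissibleE) blast
  have Af: "A f \<in> tempered_R" by (rule lsi_continuous_mem[OF AB(1) f])
  then have Af': "A f \<in> top_dual schwartz_R seminorms_R" by (simp add: tempered_R_eq)
  have D: "(distr_deriv schwartz_R ^^ N) (A f) = (\<lambda>\<phi>. 0)" using AB(4)[OF f] Lf by simp
  show N0: "f = (\<lambda>\<phi>. 0)" if "N = 0"
    using D that AB(3)[OF f] lsi_continuous_zero[OF AB(2) f] by simp
  show "translate h f = f"
  proof (cases N)
    case 0
    then show ?thesis using N0 by (simp add: translate_def)
  next
    case (Suc n)
    have "translate 1 (A f) = A f" using lsi_continuous_translate[OF AB(1) f, of 1] per by simp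
    then have "distr_deriv schwartz_R (A f) = (\<lambda>\<phi>. 0)"
      using R.periodic_distr_deriv_funpow_zero[OF Af'] D Suc by blast
    then have "translate h (A f) = A f" using R.distr_deriv_eq_zero_iff[OF Af'] by blast
    then show ?thesis
      using lsi_continuous_translate[OF AB(2) Af, of h] AB(3)[OF f] by simp
  qed
qed

text \<open>Invariance on the line gives information about \<open>g\<close> only at periodizations.
  This matches \<open>shift_invariant_eq_mean_T\<close>, which asks for invariance at one test
  function at a time.\<close>

lemma embed_T_shift_invariant_imp_zero:
  fixes g :: "('k::{real_normed_field,euclidean_space}) functional"
  assumes g: "g \<in> distributions_T" and inv: "\<And>h. translate h (embed_T g) = embed_T g"
    and one: "g (\<lambda>x. 1) = 0"
  shows "embed_T g = (\<lambda>\<phi>. 0)"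
proof
  fix \<phi> :: "'k fn"
  show "embed_T g \<phi> = 0"
  proof (cases "\<phi> \<in> schwartz_R")
    case True
    have "g (\<lambda>x. periodize \<phi> (x + h)) = g (periodize \<phi>)" for h
      using fun_cong[OF inv[of h], of \<phi>] True R.shift_mem[OF True, of h]
      by (simp add: translate_def embed_T_def periodize_shift)
    from shift_invariant_eq_mean_T[OF g periodize_mem[OF True] this]
    show ?thesis using one True by (simp add: embed_T_def)
  qed (simp add: embed_T_def)
qed

text \<open>Here positive order matters: \<open>A\<close> preserves the shift invariance of the
  constant, the innermost \<open>D\<close> annihilates the result, and the remaining derivatives act
  on 0.\<close>

lemma embed_one_T_mem_M_R:
  fixes L :: "('k::{real_normed_field,euclidean_space}) functional \<Rightarrow> 'k functional"
  assumes adm: "trend_admissible (Suc n) L"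
  shows "embed_T one_T \<in> M_R L"
proof -
  obtain A B where AB: "lsi_continuous tempered_R A"
    "\<And>f. f \<in> tempered_R \<Longrightarrow> L f = (distr_deriv schwartz_R ^^ Suc n) (A f)"
    using adm by (rule trend_admissibleE) blast
  let ?e = "embed_T one_T :: 'k functional"
  have e: "?e \<in> tempered_R" by (rule embed_T_mem[OF one_T_mem])
  have "translate h ?e = ?e" for h
    unfolding embed_T_translate[symmetric] translate_one_T ..
  then have "translate h (A ?e) = A ?e" for h
    using lsi_continuous_translate[OF AB(1) e, of h] by simp
  moreover have "A ?e \<in> top_dual schwartz_R seminorms_R"
    using lsi_continuous_mem[OF AB(1) e] by (simp add: tempered_R_eq)
  ultimately have D: "distr_deriv schwartz_R (A ?e) = (\<lambda>\<phi>. 0)"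
    using R.distr_deriv_eq_zero_iff by blast
  have "(distr_deriv schwartz_R ^^ n) (\<lambda>\<phi>. 0) = (\<lambda>\<phi>. 0)"
    by (induction n) (auto simp: distr_deriv_def)
  then have "L ?e = (\<lambda>\<phi>. 0)"
    using AB(2)[OF e] D by (simp only: funpow_Suc_right o_apply)
  then show ?thesis using e is_measure_R_zero by (simp add: M_R_def)
qed

text \<open>Shift invariance passes to the image under \<open>L\<close>, and a shift-invariant
  distribution on the circle is a multiple of the mean, hence a measure.\<close>

lemma one_T_mem_M_T:
  assumes L: "lsi_continuous distributions_T L" shows "one_T \<in> M_T L"
proof -
  have mem: "L one_T \<in> distributions_T" by (rule lsi_continuous_mem[OF L one_T_mem])
  have "translate h (L one_T) = L one_T" for h
    using lsi_continuous_translate[OF L one_T_mem, of h] by (simp add: translate_one_T)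
  then have inv: "L one_T (\<lambda>x. \<phi> (x + h)) = L one_T \<phi>" if "\<phi> \<in> schwartz_T" for \<phi> h
    using T.translate_eq_iff[OF mem[unfolded distributions_T_eq]] that by blast
  have "L one_T \<phi> = mean_T \<phi> * L one_T (\<lambda>x. 1)" if "\<phi> \<in> schwartz_T" for \<phi>
    by (rule shift_invariant_eq_mean_T[OF mem that inv[OF that]])
  then have "is_measure_T (L one_T)"
    unfolding is_measure_T_def
    using schwartz_T_subset_C_T mean_T_measure[of "L one_T (\<lambda>x. 1)"]
    by (intro bexI) auto
  then show ?thesis using one_T_mem by (simp add: M_T_def)
qed

text \<open>Constants belong to both summands, so the mean of the seasonal part can be handed over
  to the trend part.\<close>

lemma M_R_plus_embed_T_eq:
  fixes L_T L_S :: "('k::{real_normed_field,euclidean_space}) functional \<Rightarrow> 'k functional"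
  assumes T: "trend_admissible (Suc n) L_T" and S: "lsi_continuous distributions_T L_S"
  shows "M_R L_T + embed_T ` M_T L_S = M_R L_T + embed_T ` M_T0 L_S"
proof (rule antisym)
  show "M_R L_T + embed_T ` M_T0 L_S \<subseteq> M_R L_T + embed_T ` M_T L_S"
    by (rule set_plus_mono2) (auto simp: M_T0_def)
  have LT: "lsi_continuous tempered_R L_T" using T by (rule trend_admissibleE)
  show "M_R L_T + embed_T ` M_T L_S \<subseteq> M_R L_T + embed_T ` M_T0 L_S"
  proof
    fix w assume "w \<in> M_R L_T + embed_T ` M_T L_S"
    then obtain f g where f: "f \<in> M_R L_T" and g: "g \<in> M_T L_S" and w: "w = f + embed_T g"
      by (auto elim!: set_plus_elim)
    \<comment> \<open>Since \<open>one_T\<close> has mean 1, this multiple of it is what has to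
      change sides.\<close>
    define c where "c = g (\<lambda>x. 1)"
    define f' where "f' = (\<lambda>\<phi>. 1 * f \<phi> + c * embed_T one_T \<phi>)"
    define g' where "g' = (\<lambda>\<phi>. 1 * g \<phi> + (- c) * one_T \<phi>)"
    have "f' \<in> M_R L_T"
      unfolding f'_def by (rule M_R_lincomb[OF LT f embed_one_T_mem_M_R[OF T]])
    moreover have "g' \<in> M_T L_S"
      unfolding g'_def by (rule M_T_lincomb[OF S g one_T_mem_M_T[OF S]])
    then have "g' \<in> M_T0 L_S"
      by (simp add: M_T0_def g'_def c_def one_T_def const_mem_schwartz_T mean_T_const)
    moreover have "w = f' + embed_T g'"
      unfolding w g'_def embed_T_lincomb by (simp add: f'_def fun_eq_iff)
    ultimately show "w \<in> M_R L_T + embed_T ` M_T0 L_S" by (auto intro: set_plus_intro)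
  qed
qed

theorem proposition2:
  fixes L_T L_S :: "('k::{real_normed_field,euclidean_space}) functional \<Rightarrow> 'k functional"
    and N_T N_S :: nat
  assumes "trend_admissible N_T L_T"
    and "seasonal_admissible N_S L_S"
  shows "M_R L_T + embed_T ` M_T L_S \<subseteq> tempered_R \<and>
    (N_T = 0 \<longrightarrow>
       is_direct_sum (M_R L_T + embed_T ` M_T L_S) (M_R L_T) (embed_T ` M_T L_S)) \<and>
    (N_T \<ge> 1 \<longrightarrow>
       is_direct_sum (M_R L_T + embed_T ` M_T L_S) (M_R L_T) (embed_T ` M_T0 L_S))"
proof (intro conjI impI)
  have LT: "lsi_continuous tempered_R L_T" using assms(1) by (rule trend_admissibleE)
  have LS: "lsi_continuous distributions_T L_S"
    using assms(2) by (simp add: seasonal_admissible_def admissible_def)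
  have U: "functional_space.subspace (M_R L_T)"
    by (rule subspaceI_lincomb[OF zero_mem_M_R[OF LT] M_R_lincomb[OF LT]])
  \<comment> \<open>An element common to both summands is periodic as an embedded distribution and
    has a measure as its image under \<open>L_T\<close>; that image is then 0, so the kernel
    description applies.\<close>
  have inv: "translate h (embed_T g) = embed_T g" and zero: "N_T = 0 \<Longrightarrow> embed_T g = (\<lambda>\<phi>. 0)"
    if "embed_T g \<in> M_R L_T" "g \<in> M_T L_S" for g h
  proof -
    have "g \<in> distributions_T" using that(2) by (simp add: M_T_def)
    then have "translate 1 (embed_T g) = embed_T g"
      using embed_T_translate[of 1 g] by (simp add: translate_one_distribution_T)
    moreover have "embed_T g \<in> tempered_R" using that(1) by (simp add: M_R_def)
    ultimately show "translate h (embed_T g) = embed_T g" "N_T = 0 \<Longrightarrow> embed_T g = (\<lambda>\<phi>. 0)"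
      using trend_kernel_on_periodic[OF assms(1)] periodic_M_R_imp_zero[OF LT that(1)] by blast+
  qed
  show "M_R L_T + embed_T ` M_T L_S \<subseteq> tempered_R"
  proof
    fix w assume "w \<in> M_R L_T + embed_T ` M_T L_S"
    then obtain f g where w: "w = f + embed_T g"
      and "f \<in> M_R L_T" "g \<in> M_T L_S" by (auto elim!: set_plus_elim)
    then have "f \<in> tempered_R" "embed_T g \<in> tempered_R" by (auto simp: M_R_def M_T_def embed_T_mem)
    then show "w \<in> tempered_R"
      using R.top_dual_lincomb[of f "embed_T g" 1 1] by (simp add: w tempered_R_eq plus_fun_def)
  qed
  show "is_direct_sum (M_R L_T + embed_T ` M_T L_S) (M_R L_T) (embed_T ` M_T L_S)" if "N_T = 0"
  proof (rule is_direct_sumI[OF U _ refl])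
    show "functional_space.subspace (embed_T ` M_T L_S)"
      by (rule subspace_embed_T_image[OF zero_mem_M_T[OF LS] M_T_lincomb[OF LS]])
    show "f = 0" if "f \<in> M_R L_T" "f \<in> embed_T ` M_T L_S" for f
      using that zero \<open>N_T = 0\<close> by (auto simp: zero_fun_def)
  qed
  show "is_direct_sum (M_R L_T + embed_T ` M_T L_S) (M_R L_T) (embed_T ` M_T0 L_S)" if "N_T \<ge> 1"
  proof (rule is_direct_sumI[OF U])
    obtain n where "N_T = Suc n" using \<open>1 \<le> N_T\<close> by (auto dest: Suc_le_D)
    then show "M_R L_T + embed_T ` M_T L_S = M_R L_T + embed_T ` M_T0 L_S"
      using M_R_plus_embed_T_eq assms(1) LS by blast
    show "functional_space.subspace (embed_T ` M_T0 L_S)"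
    proof (rule subspace_embed_T_image)
      show "(\<lambda>\<phi>. 0) \<in> M_T0 L_S" using zero_mem_M_T[OF LS] by (simp add: M_T0_def)
      show "(\<lambda>\<phi>. a * f \<phi> + b * g \<phi>) \<in> M_T0 L_S" if "f \<in> M_T0 L_S" "g \<in> M_T0 L_S" for f g a b
        using that M_T_lincomb[OF LS, of f g a b] by (simp add: M_T0_def)
    qed
    \<comment> \<open>A common element is shift invariant, hence determined by the mean of
      \<open>g\<close>, which vanishes on \<open>M_T0 L_S\<close>.\<close>
    show "f = 0" if f: "f \<in> M_R L_T" "f \<in> embed_T ` M_T0 L_S" for f
    proof -
      obtain g where g: "f = embed_T g" "g \<in> M_T L_S" "g (\<lambda>x. 1) = 0"
        using f(2) by (auto simp: M_T0_def)
      moreover have "g \<in> distributions_T" using g(2) by (simp add: M_T_def)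
      ultimately show ?thesis
        using embed_T_shift_invariant_imp_zero[of g] inv f(1) by (simp add: zero_fun_def)
    qed
  qed
qed

end
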